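(* Let $G$ be an amenable, just infinite group. If $(\operatorname{rad}\ell^1(G)^{**})^{\Box 2}=\{0\}$, then $G$ is hereditarily just infinite.
   Context: All groups are discrete. For a group $G$, $\ell^1(G)$ is the Banach algebra of absolutely summable functions $G\to\mathbb{C}$ under convolution. The bidual $\ell^1(G)^{**}$ carries the first Arens product $\Box$: for a Banach algebra $A$, $\langle \Psi\Box\Phi,\lambda\rangle=\langle\Psi,\Phi\cdot\lambda\rangle$, $\langle a,\Phi\cdot\lambda\rangle=\langle\Phi,\lambda\cdot a\rangle$, $\langle b,\lambda\cdot a\rangle=\langle ab,\lambda\rangle$ ($\Phi,\Psi\in A^{**}$, $\lambda\in A^*$, $a,b\in A$). The Jacobson radical $\operatorname{rad}A$ of a unital algebra $A$ is the intersection of its maximal left ideals; here it is taken for the algebra $(\ell^1(G)^{**},\Box)$. For a subspace $I$, $I^{\Box 2}=\{0\}$ means $\Phi\Box\Psi=0$ for all $\Phi,\Psi\in I$. An infinite group is just infinite if every non-trivial normal subgroup has finite index. It is hereditarily just infinite if every non-trivial normal subgroup of it is just infinite. *)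

theory Defs
  imports "HOL-Analysis.Analysis" "HOL-Algebra.Coset" "HOL-Algebra.Ideal" "HOL-Algebra.Module"
begin

section \<open>Complex normed algebras, their duals and the first Arens product\<close>

record 'a cnormed_algebra = "(complex, 'a) module" +
  nrm :: "'a \<Rightarrow> real"

definition bounded_functional ::
    "('a, 'm) cnormed_algebra_scheme \<Rightarrow> ('a \<Rightarrow> complex) \<Rightarrow> bool" where
  "bounded_functional A f \<longleftrightarrow>
     (\<forall>x\<in>carrier A. \<forall>y\<in>carrier A. f (x \<oplus>\<^bsub>A\<^esub> y) = f x + f y) \<and>
     (\<forall>c. \<forall>x\<in>carrier A. f (c \<odot>\<^bsub>A\<^esub> x) = c * f x) \<and>
     (\<exists>K. \<forall>x\<in>carrier A. cmod (f x) \<le> K * nrm A x)"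

text \<open>
  Functions on a carrier set are represented by functions on the whole type that vanish off the
  carrier, so that equality is equality on the carrier. The dual of \<open>A\<close> is only a normed space:
  its fields \<open>mult\<close> and \<open>one\<close> are junk.
\<close>

definition dual :: "('a, 'm) cnormed_algebra_scheme \<Rightarrow> ('a \<Rightarrow> complex) cnormed_algebra" where
  "dual A =
     \<lparr>carrier = {f. bounded_functional A f \<and> (\<forall>x. x \<notin> carrier A \<longrightarrow> f x = 0)},
      mult = undefined,
      one = undefined,
      zero = (\<lambda>x. 0),
      add = (\<lambda>f g x. f x + g x),
      smult = (\<lambda>c f x. c * f x),
      nrm = (\<lambda>f. SUP x\<in>{x \<in> carrier A. nrm A x \<le> 1}. cmod (f x))\<rparr>"

definition dual_act ::
    "('a, 'm) cnormed_algebra_scheme \<Rightarrow> ('a \<Rightarrow> complex) \<Rightarrow> 'a \<Rightarrow> 'a \<Rightarrow> complex" where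
  "dual_act A l a = (\<lambda>b. if b \<in> carrier A then l (a \<otimes>\<^bsub>A\<^esub> b) else 0)"

definition bidual_act ::
    "('a, 'm) cnormed_algebra_scheme \<Rightarrow> (('a \<Rightarrow> complex) \<Rightarrow> complex) \<Rightarrow> ('a \<Rightarrow> complex) \<Rightarrow> 'a \<Rightarrow> complex"
  where
  "bidual_act A \<Phi> l = (\<lambda>a. if a \<in> carrier A then \<Phi> (dual_act A l a) else 0)"

definition arens ::
    "('a, 'm) cnormed_algebra_scheme \<Rightarrow>
     (('a \<Rightarrow> complex) \<Rightarrow> complex) \<Rightarrow> (('a \<Rightarrow> complex) \<Rightarrow> complex) \<Rightarrow> ('a \<Rightarrow> complex) \<Rightarrow> complex" where
  "arens A \<Psi> \<Phi> = (\<lambda>l. if l \<in> carrier (dual A) then \<Psi> (bidual_act A \<Phi> l) else 0)"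

text \<open>The identity of the bidual is the canonical image of the identity of \<open>A\<close>.\<close>

definition bidual ::
    "('a, 'm) cnormed_algebra_scheme \<Rightarrow> (('a \<Rightarrow> complex) \<Rightarrow> complex) cnormed_algebra" where
  "bidual A = (dual (dual A))
     \<lparr>mult := arens A,
      one := (\<lambda>l. if l \<in> carrier (dual A) then l \<one>\<^bsub>A\<^esub> else 0)\<rparr>"

section \<open>The Jacobson radical\<close>

text \<open>
  In a unital algebra a left ideal of the underlying ring is automatically a linear subspace,
  because \<open>c \<odot> x = (c \<odot> \<one>) \<otimes> x\<close>.
\<close>

definition left_ideal :: "'a set \<Rightarrow> ('a, 'm) ring_scheme \<Rightarrow> bool" where
  "left_ideal I R \<longleftrightarrow>
     additive_subgroup I R \<and> (\<forall>r\<in>carrier R. \<forall>x\<in>I. r \<otimes>\<^bsub>R\<^esub> x \<in> I)"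

definition maximal_left_ideal :: "'a set \<Rightarrow> ('a, 'm) ring_scheme \<Rightarrow> bool" where
  "maximal_left_ideal I R \<longleftrightarrow>
     left_ideal I R \<and> I \<noteq> carrier R \<and>
     (\<forall>J. left_ideal J R \<and> I \<subseteq> J \<longrightarrow> J = I \<or> J = carrier R)"

definition jacobson_radical :: "('a, 'm) ring_scheme \<Rightarrow> 'a set" where
  "jacobson_radical R = {x \<in> carrier R. \<forall>M. maximal_left_ideal M R \<longrightarrow> x \<in> M}"

section \<open>Function algebras on a discrete group\<close>

definition l1 :: "('g, 'm) monoid_scheme \<Rightarrow> ('g \<Rightarrow> complex) cnormed_algebra" where
  "l1 G =
     \<lparr>carrier = {f. (\<lambda>x. cmod (f x)) summable_on carrier G \<and> (\<forall>x. x \<notin> carrier G \<longrightarrow> f x = 0)},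
      mult = (\<lambda>f g x. if x \<in> carrier G
                       then \<Sum>\<^sub>\<infinity>y\<in>carrier G. f y * g (inv\<^bsub>G\<^esub> y \<otimes>\<^bsub>G\<^esub> x) else 0),
      one = (\<lambda>x. if x = \<one>\<^bsub>G\<^esub> then 1 else 0),
      zero = (\<lambda>x. 0),
      add = (\<lambda>f g x. f x + g x),
      smult = (\<lambda>c f x. c * f x),
      nrm = (\<lambda>f. \<Sum>\<^sub>\<infinity>x\<in>carrier G. cmod (f x))\<rparr>"

definition linf :: "('g, 'm) monoid_scheme \<Rightarrow> ('g \<Rightarrow> complex) cnormed_algebra" where
  "linf G =
     \<lparr>carrier = {f. bounded (f ` carrier G) \<and> (\<forall>x. x \<notin> carrier G \<longrightarrow> f x = 0)},
      mult = (\<lambda>f g x. f x * g x),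
      one = (\<lambda>x. if x \<in> carrier G then 1 else 0),
      zero = (\<lambda>x. 0),
      add = (\<lambda>f g x. f x + g x),
      smult = (\<lambda>c f x. c * f x),
      nrm = (\<lambda>f. SUP x\<in>carrier G. cmod (f x))\<rparr>"

section \<open>Amenable and just infinite groups\<close>

definition left_translate ::
    "('g, 'm) monoid_scheme \<Rightarrow> 'g \<Rightarrow> ('g \<Rightarrow> complex) \<Rightarrow> 'g \<Rightarrow> complex" where
  "left_translate G g f = (\<lambda>x. if x \<in> carrier G then f (g \<otimes>\<^bsub>G\<^esub> x) else 0)"

text \<open>Amenability is the existence of a left-invariant mean.\<close>

definition amenable :: "('g, 'm) monoid_scheme \<Rightarrow> bool" where
  "amenable G \<longleftrightarrow>
     (\<exists>m\<in>carrier (dual (linf G)).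
        nrm (dual (linf G)) m = 1 \<and> m \<one>\<^bsub>linf G\<^esub> = 1 \<and>
        (\<forall>g\<in>carrier G. \<forall>f\<in>carrier (linf G). m (left_translate G g f) = m f))"

definition just_infinite :: "('g, 'm) monoid_scheme \<Rightarrow> bool" where
  "just_infinite G \<longleftrightarrow>
     infinite (carrier G) \<and> (\<forall>N. N \<lhd> G \<and> N \<noteq> {\<one>\<^bsub>G\<^esub>} \<longrightarrow> finite (rcosets\<^bsub>G\<^esub> N))"

definition hereditarily_just_infinite :: "('g, 'm) monoid_scheme \<Rightarrow> bool" where
  "hereditarily_just_infinite G \<longleftrightarrow>
     infinite (carrier G) \<and>
     (\<forall>N. N \<lhd> G \<and> N \<noteq> {\<one>\<^bsub>G\<^esub>} \<longrightarrow> just_infinite (G\<lparr>carrier := N\<rparr>))"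

end

theory Submission
  imports Defs "HOL-Algebra.Generated_Groups" "HOL-Algebra.SndIsomorphismGrp"
begin

text \<open>
  Suppose \<open>N\<close> is a non-trivial normal subgroup of \<open>G\<close> that is not just infinite, and let \<open>M\<close> be a
  non-trivial normal subgroup of \<open>N\<close> of infinite index. \<open>M\<close> is infinite, since otherwise the product
  of its finitely many conjugates would be a finite normal subgroup of \<open>G\<close>.

  For \<open>H \<in> {M, N}\<close>, the functionals concentrated on \<open>N\<close> that are left invariant under \<open>H\<close> and
  vanish on right \<open>H\<close>-invariant functions form an ideal of square zero in the bidual of \<open>\<ell>\<^sup>1(N)\<close>.
  As \<open>N\<close> is normal of finite index, a Clifford-type argument shows that this ideal annihilates every
  simple module over the bidual of \<open>\<ell>\<^sup>1(G)\<close>, so it lies in the radical.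

  An infinite group contains a set such that both it and its complement contain a translate of every
  finite set. Such a set \<open>A\<close> in \<open>M\<close> separates two \<open>M\<close>-invariant means on \<open>M\<close>, whose difference is
  a radical element \<open>\<Psi>\<close>; the preimage \<open>R\<close> of such a set in \<open>N/M\<close> likewise gives an
  \<open>N\<close>-invariant radical element \<open>\<Phi>\<close>. On the set of all \<open>t \<otimes> a\<close> with \<open>a \<in> A\<close> and \<open>t \<in> R\<close> a
  representative of a coset of \<open>M\<close>, the product \<open>\<Phi> \<box> \<Psi>\<close> takes the value \<open>1\<close>.
\<close>

section \<open>Left ideals and the Jacobson radical\<close>

text \<open>For a maximal \<open>M\<close> and \<open>v \<notin> M\<close> this left ideal properly
  contains \<open>M\<close>, so it is the whole ring. That gives an equation
  \<open>\<one> = m \<oplus> b \<otimes> v\<close>, which is how maximality is used below.\<close>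

lemma (in ring) left_ideal_add_mult:
  assumes M: "left_ideal M R" and v: "v \<in> carrier R"
  shows "left_ideal {m \<oplus> b \<otimes> v | m b. m \<in> M \<and> b \<in> carrier R} R" (is "left_ideal ?J R")
proof -
  have Ms: "additive_subgroup M R" and Ml: "\<And>r x. r \<in> carrier R \<Longrightarrow> x \<in> M \<Longrightarrow> r \<otimes> x \<in> M"
    using M by (auto simp: left_ideal_def)
  note Mc [simp] = additive_subgroup.a_Hcarr [OF Ms]
  have "subgroup ?J (add_monoid R)"
  proof (rule add.subgroupI)
    show "?J \<subseteq> carrier R" using v by auto
    show "?J \<noteq> {}" using additive_subgroup.zero_closed [OF Ms] by blast
  next
    fix a assume "a \<in> ?J"
    then obtain m b where mb: "a = m \<oplus> b \<otimes> v" "m \<in> M" "b \<in> carrier R" by blast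
    have "\<ominus> a = (\<ominus> m) \<oplus> (\<ominus> b) \<otimes> v" using mb v by (simp add: minus_add l_minus)
    moreover have "\<ominus> m \<in> M" using Ms mb(2) by (simp add: abelian_subgroupI3 additive_subgroup.a_inv_closed abelian_group_axioms)
    ultimately show "\<ominus> a \<in> ?J" using mb by (blast intro: a_inv_closed)
  next
    fix a a' assume "a \<in> ?J" "a' \<in> ?J"
    then obtain m b m' b' where mb: "a = m \<oplus> b \<otimes> v" "m \<in> M" "b \<in> carrier R"
      "a' = m' \<oplus> b' \<otimes> v" "m' \<in> M" "b' \<in> carrier R" by blast
    have "a \<oplus> a' = (m \<oplus> m') \<oplus> (b \<oplus> b') \<otimes> v"
      using mb v by (simp add: l_distr a_ac)
    then show "a \<oplus> a' \<in> ?J"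
      using mb additive_subgroup.a_closed [OF Ms] by blast
  qed
  moreover have "r \<otimes> x \<in> ?J" if "r \<in> carrier R" "x \<in> ?J" for r x
  proof -
    obtain m b where mb: "x = m \<oplus> b \<otimes> v" "m \<in> M" "b \<in> carrier R" using \<open>x \<in> ?J\<close> by blast
    have "r \<otimes> x = r \<otimes> m \<oplus> (r \<otimes> b) \<otimes> v" using mb v that by (simp add: r_distr m_assoc)
    then show ?thesis using mb Ml that by blast
  qed
  ultimately show ?thesis by (auto simp: left_ideal_def intro: additive_subgroup.intro)
qed

text \<open>
  If \<open>M\<close> is a maximal left ideal, repeatedly replacing \<open>v \<notin> M\<close> by some \<open>inv (u t) \<otimes> i \<otimes> u t \<otimes> v \<notin> M\<close>
  yields \<open>v \<notin> M\<close> with \<open>i \<otimes> u t \<otimes> v \<in> M\<close> for all \<open>i \<in> I\<close>, \<open>t \<in> T\<close>. Hence \<open>I\<close> kills the cyclic,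
  and so all of the, simple module \<open>R / M\<close>.
\<close>

lemma (in ring) subset_jacobson_radicalI:
  assumes T: "finite T" "u \<in> T \<rightarrow> Units R" and I: "I \<subseteq> carrier R"
    and sq: "\<And>i j. i \<in> I \<Longrightarrow> j \<in> I \<Longrightarrow> j \<otimes> i = \<zero>"
    and conj: "\<And>s t i j. s \<in> T \<Longrightarrow> t \<in> T \<Longrightarrow> i \<in> I \<Longrightarrow> j \<in> I \<Longrightarrow>
                 j \<otimes> (u s \<otimes> inv u t \<otimes> i \<otimes> u t \<otimes> inv u s) \<in> I"
    and decomp: "\<And>b. b \<in> carrier R \<Longrightarrow>
       \<exists>c\<in>T \<rightarrow> carrier R. b = (\<Oplus>t\<in>T. c t \<otimes> u t) \<and> (\<forall>t\<in>T. \<forall>i\<in>I. i \<otimes> c t \<in> I)"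
  shows "I \<subseteq> jacobson_radical R"
proof
  fix i0 assume i0: "i0 \<in> I"
  note Ic [simp] = subsetD [OF I] and Tu [simp] = funcset_mem [OF T(2)]
  have Tc [simp]: "t \<in> T \<Longrightarrow> u t \<in> carrier R" for t using Tu by blast
  have "i0 \<in> M" if "maximal_left_ideal M R" for M
  proof -
    have M: "left_ideal M R" and Mne: "M \<noteq> carrier R"
      and Mmax: "\<And>J. left_ideal J R \<Longrightarrow> M \<subseteq> J \<Longrightarrow> J = M \<or> J = carrier R"
      using that by (auto simp: maximal_left_ideal_def)
    have Ms: "additive_subgroup M R" and Ml: "\<And>r x. r \<in> carrier R \<Longrightarrow> x \<in> M \<Longrightarrow> r \<otimes> x \<in> M"
      using M by (auto simp: left_ideal_def)
    note Mc = additive_subgroup.a_Hcarr [OF Ms] and Mz = additive_subgroup.zero_closed [OF Ms]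
      and Ma = additive_subgroup.a_closed [OF Ms]
    have one: "\<one> \<notin> M"
      using Ml [of _ \<one>] Mne Mc by auto
    have "\<exists>v\<in>carrier R - M. \<forall>t\<in>S. \<forall>i\<in>I. i \<otimes> u t \<otimes> v \<in> M" if "S \<subseteq> T" for S
      using finite_subset [OF that T(1)] that
    proof (induction S rule: finite_induct)
      case empty
      then show ?case using one by auto
    next
      case (insert g S)
      then have g [simp]: "g \<in> T" and S: "S \<subseteq> T" by auto
      from insert.IH [OF S] obtain v where v [simp]: "v \<in> carrier R" and vM: "v \<notin> M"
        and vS: "\<And>t i. t \<in> S \<Longrightarrow> i \<in> I \<Longrightarrow> i \<otimes> u t \<otimes> v \<in> M" by blast
      show ?case
      proof (cases "\<forall>i\<in>I. i \<otimes> u g \<otimes> v \<in> M")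
        case True
        then show ?thesis using v vM vS by blast
      next
        case False
        then obtain i where i: "i \<in> I" "i \<otimes> u g \<otimes> v \<notin> M" by blast
        note [simp] = i(1)
        \<comment> \<open>Multiplying \<open>w\<close> by \<open>u g\<close> returns
          \<open>i \<otimes> u g \<otimes> v\<close>, which is outside \<open>M\<close>, so
          \<open>w\<close> is outside \<open>M\<close> as well. At \<open>g\<close> itself the new
          vector is killed because \<open>j \<otimes> i = \<zero>\<close>.\<close>
        define w where "w = inv u g \<otimes> (i \<otimes> u g \<otimes> v)"
        have w [simp]: "w \<in> carrier R" by (simp add: w_def)
        have gw: "u g \<otimes> w = i \<otimes> u g \<otimes> v"
          unfolding w_def by (subst m_assoc [symmetric]) simp_all
        then have "w \<notin> M" using Ml [of "u g" w] i(2) by auto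
        moreover have "j \<otimes> u g \<otimes> w \<in> M" if j: "j \<in> I" for j
        proof -
          have "j \<otimes> u g \<otimes> w = j \<otimes> (u g \<otimes> w)" using j by (simp add: m_assoc)
          also have "\<dots> = (j \<otimes> i) \<otimes> (u g \<otimes> v)" using j by (simp add: gw m_assoc)
          also have "\<dots> = \<zero>" using j by (simp add: sq)
          finally show ?thesis using Mz by simp
        qed
        \<comment> \<open>The earlier members of \<open>S\<close> still kill modulo \<open>M\<close>
          after \<open>v\<close> is replaced by \<open>w\<close>:
          \<open>j \<otimes> u s \<otimes> w\<close> equals
          \<open>j' \<otimes> u s \<otimes> v\<close>, where \<open>j'\<close> is the product that
          \<open>conj\<close> places in \<open>I\<close>.\<close>
        moreover have "j \<otimes> u s \<otimes> w \<in> M" if j: "j \<in> I" and s: "s \<in> S" for j s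
        proof -
          have sT: "s \<in> T" using s S by blast
          have "j \<otimes> (u s \<otimes> inv u g \<otimes> i \<otimes> u g \<otimes> inv u s) \<otimes> u s \<otimes> v = j \<otimes> u s \<otimes> w"
          proof -
            have "inv u s \<otimes> (u s \<otimes> v) = v"
              using sT by (subst m_assoc [symmetric]) simp_all
            then show ?thesis using j sT by (simp add: w_def m_assoc)
          qed
          moreover have "j \<otimes> (u s \<otimes> inv u g \<otimes> i \<otimes> u g \<otimes> inv u s) \<otimes> u s \<otimes> v \<in> M"
            using vS [OF s] conj [OF sT g i(1) j] by blast
          ultimately show ?thesis by simp
        qed
        ultimately show ?thesis using w by blast
      qed
    qed
    from this [OF subset_refl] obtain v where v [simp]: "v \<in> carrier R" and vM: "v \<notin> M"
      and vT: "\<And>t i. t \<in> T \<Longrightarrow> i \<in> I \<Longrightarrow> i \<otimes> u t \<otimes> v \<in> M" by blast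
    let ?J = "{m \<oplus> b \<otimes> v | m b. m \<in> M \<and> b \<in> carrier R}"
    have "m \<in> ?J" if "m \<in> M" for m
    proof -
      have "m = m \<oplus> \<zero> \<otimes> v" using that Mc by simp
      then show ?thesis using that by blast
    qed
    moreover have "v \<in> ?J"
    proof -
      have "v = \<zero> \<oplus> \<one> \<otimes> v" by simp
      then show ?thesis using Mz by blast
    qed
    ultimately have "?J = carrier R"
      using Mmax [OF left_ideal_add_mult [OF M v]] vM by blast
    then obtain m b where mb: "\<one> = m \<oplus> b \<otimes> v" "m \<in> M" "b \<in> carrier R"
      using one_closed by blast
    obtain c where c: "c \<in> T \<rightarrow> carrier R" and bc: "b = (\<Oplus>t\<in>T. c t \<otimes> u t)"
      and ci: "\<And>t i. t \<in> T \<Longrightarrow> i \<in> I \<Longrightarrow> i \<otimes> c t \<in> I"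
      using decomp [OF mb(3)] by blast
    have cT [simp]: "t \<in> T \<Longrightarrow> c t \<in> carrier R" for t using c by blast
    have sumM: "(\<Oplus>t\<in>S. f t) \<in> M" if "finite S" "\<And>t. t \<in> S \<Longrightarrow> f t \<in> M" for S f
      using that
    proof (induction S rule: finite_induct)
      case (insert x F)
      then show ?case using Mc Ma by (subst finsum_insert) auto
    qed (simp add: Mz)
    \<comment> \<open>Each \<open>i0 \<otimes> c t\<close> lies in \<open>I\<close>, so every
      summand lies in \<open>M\<close>. Multiplying \<open>\<one> = m \<oplus> b \<otimes> v\<close>
      by \<open>i0\<close> on the left then puts \<open>i0\<close> into \<open>M\<close>.\<close>
    have "i0 \<otimes> b \<otimes> v = (\<Oplus>t\<in>T. i0 \<otimes> (c t \<otimes> u t) \<otimes> v)"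
      using i0 T(1) unfolding bc by (simp add: finsum_rdistr finsum_ldistr)
    also have "\<dots> = (\<Oplus>t\<in>T. (i0 \<otimes> c t) \<otimes> u t \<otimes> v)"
      using i0 by (intro finsum_cong') (auto simp: m_assoc)
    also have "\<dots> \<in> M"
      by (intro sumM T(1) vT ci i0)
    finally have "i0 \<otimes> (b \<otimes> v) \<in> M" using mb i0 by (simp add: m_assoc)
    then have "i0 \<otimes> m \<oplus> i0 \<otimes> (b \<otimes> v) \<in> M" using mb Ml i0 Ma by simp
    also have "i0 \<otimes> m \<oplus> i0 \<otimes> (b \<otimes> v) = i0 \<otimes> (m \<oplus> b \<otimes> v)"
      using mb i0 Mc by (simp add: r_distr)
    finally show ?thesis using i0 by (simp flip: mb(1))
  qed
  then show "i0 \<in> jacobson_radical R" using i0 by (simp add: jacobson_radical_def)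
qed

section \<open>The dual of \<open>\<ell>\<^sup>1(G)\<close>\<close>

context group
begin

definition bounded_fun :: "('a \<Rightarrow> complex) \<Rightarrow> bool" where
  "bounded_fun f \<longleftrightarrow> (\<exists>C. \<forall>x\<in>carrier G. cmod (f x) \<le> C)"

text \<open>The value 0 off the carrier makes \<open>l1_pair f\<close>, for bounded
  \<open>f\<close>, literally an element of \<open>carrier (dual (l1 G))\<close>.\<close>

definition l1_pair :: "('a \<Rightarrow> complex) \<Rightarrow> ('a \<Rightarrow> complex) \<Rightarrow> complex" where
  "l1_pair f = (\<lambda>a. if a \<in> carrier (l1 G) then \<Sum>\<^sub>\<infinity>x\<in>carrier G. a x * f x else 0)"

definition point :: "'a \<Rightarrow> 'a \<Rightarrow> complex" where
  "point x = (\<lambda>y. if y = x then 1 else 0)"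

lemma l1_carrier_iff:
  "a \<in> carrier (l1 G) \<longleftrightarrow> (\<lambda>x. cmod (a x)) summable_on carrier G \<and> (\<forall>x. x \<notin> carrier G \<longrightarrow> a x = 0)"
  by (simp add: l1_def)

lemma l1_sel [simp]:
  "a \<oplus>\<^bsub>l1 G\<^esub> b = (\<lambda>x. a x + b x)" "c \<odot>\<^bsub>l1 G\<^esub> a = (\<lambda>x. c * a x)"
  "nrm (l1 G) a = (\<Sum>\<^sub>\<infinity>x\<in>carrier G. cmod (a x))" "\<one>\<^bsub>l1 G\<^esub> = point \<one>"
  by (simp_all add: l1_def point_def)

lemma l1_add_closed: "a \<in> carrier (l1 G) \<Longrightarrow> b \<in> carrier (l1 G) \<Longrightarrow> (\<lambda>x. a x + b x) \<in> carrier (l1 G)"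
  unfolding l1_carrier_iff
  by (auto intro!: norm_triangle_ineq
      Infinite_Sum.abs_summable_on_comparison_test' [where g = "\<lambda>x. cmod (a x) + cmod (b x)"]
      summable_on_add)

lemma l1_smult_closed: "a \<in> carrier (l1 G) \<Longrightarrow> (\<lambda>x. c * a x) \<in> carrier (l1 G)"
  unfolding l1_carrier_iff by (auto simp: norm_mult intro!: summable_on_cmult_right)

lemma l1_restrict_closed: "a \<in> carrier (l1 G) \<Longrightarrow> (\<lambda>x. if x \<in> F then a x else 0) \<in> carrier (l1 G)"
  unfolding l1_carrier_iff
  by (auto intro!: Infinite_Sum.abs_summable_on_comparison_test' [where g = "\<lambda>x. cmod (a x)"])

lemma l1_finite_closed:
  assumes "finite F" "F \<subseteq> carrier G"
  shows "(\<lambda>x. if x \<in> F then a x else 0) \<in> carrier (l1 G)"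
  unfolding l1_carrier_iff
  using assms by (auto intro!: finite_nonzero_values_imp_summable_on elim!: rev_finite_subset
      split: if_splits)

lemma point_closed: "x \<in> carrier G \<Longrightarrow> point x \<in> carrier (l1 G)"
  using l1_finite_closed [of "{x}" "\<lambda>_. 1"] by (simp add: point_def)

lemma infsum_point: "x \<in> carrier G \<Longrightarrow> (\<Sum>\<^sub>\<infinity>y\<in>carrier G. point x y * f y) = f x"
proof -
  assume x: "x \<in> carrier G"
  have "(\<Sum>\<^sub>\<infinity>y\<in>carrier G. point x y * f y) = (\<Sum>\<^sub>\<infinity>y\<in>{x}. point x y * f y)"
    using x by (intro infsum_cong_neutral) (auto simp: point_def)
  then show ?thesis by (simp add: point_def)
qed

lemma l1_pair_point: "x \<in> carrier G \<Longrightarrow> l1_pair f (point x) = f x"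
  by (simp add: l1_pair_def point_closed infsum_point)

lemma nrm_point: "x \<in> carrier G \<Longrightarrow> nrm (l1 G) (point x) = 1"
proof -
  assume x: "x \<in> carrier G"
  have "(\<Sum>\<^sub>\<infinity>y\<in>carrier G. cmod (point x y)) = (\<Sum>\<^sub>\<infinity>y\<in>{x}. cmod (point x y))"
    using x by (intro infsum_cong_neutral) (auto simp: point_def)
  then show ?thesis by (simp add: point_def)
qed

lemma l1_pair_summable:
  assumes "a \<in> carrier (l1 G)" "\<And>x. x \<in> carrier G \<Longrightarrow> cmod (f x) \<le> C"
  shows "(\<lambda>x. cmod (a x * f x)) summable_on carrier G"
    and "(\<lambda>x. a x * f x) summable_on carrier G"
    and "cmod (\<Sum>\<^sub>\<infinity>x\<in>carrier G. a x * f x) \<le> C * nrm (l1 G) a"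
proof -
  have le: "cmod (a x * f x) \<le> C * cmod (a x)" if "x \<in> carrier G" for x
    using mult_left_mono [OF assms(2) [OF that] norm_ge_zero [of "a x"]]
    by (simp add: norm_mult mult.commute)
  have sa: "(\<lambda>x. C * cmod (a x)) summable_on carrier G"
    using assms(1) by (auto simp: l1_carrier_iff intro: summable_on_cmult_right)
  show *: "(\<lambda>x. cmod (a x * f x)) summable_on carrier G"
    by (rule Infinite_Sum.abs_summable_on_comparison_test' [OF sa le])
  show "(\<lambda>x. a x * f x) summable_on carrier G"
    by (rule abs_summable_summable [OF *])
  have "cmod (\<Sum>\<^sub>\<infinity>x\<in>carrier G. a x * f x) \<le> (\<Sum>\<^sub>\<infinity>x\<in>carrier G. cmod (a x * f x))"
    by (rule norm_infsum_bound [OF *])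
  also have "\<dots> \<le> (\<Sum>\<^sub>\<infinity>x\<in>carrier G. C * cmod (a x))"
    by (rule infsum_mono [OF * sa le])
  also have "\<dots> = C * nrm (l1 G) a"
    by (simp add: infsum_cmult_right')
  finally show "cmod (\<Sum>\<^sub>\<infinity>x\<in>carrier G. a x * f x) \<le> C * nrm (l1 G) a" .
qed

lemma l1_pair_in_dual:
  assumes "bounded_fun f"
  shows "l1_pair f \<in> carrier (dual (l1 G))"
proof -
  obtain C where C: "\<And>x. x \<in> carrier G \<Longrightarrow> cmod (f x) \<le> C"
    using assms by (auto simp: bounded_fun_def)
  have "l1_pair f (\<lambda>x. a x + b x) = l1_pair f a + l1_pair f b"
    if "a \<in> carrier (l1 G)" "b \<in> carrier (l1 G)" for a b
    using that infsum_add [OF l1_pair_summable(2) [OF that(1) C] l1_pair_summable(2) [OF that(2) C]]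
    by (simp add: l1_pair_def l1_add_closed distrib_right)
  moreover have "l1_pair f (\<lambda>x. c * a x) = c * l1_pair f a" if "a \<in> carrier (l1 G)" for a c
    using that by (simp add: l1_pair_def l1_smult_closed mult.assoc infsum_cmult_right')
  moreover have "cmod (l1_pair f a) \<le> C * nrm (l1 G) a" if "a \<in> carrier (l1 G)" for a
    using that l1_pair_summable(3) [OF that C] by (simp add: l1_pair_def)
  ultimately have "bounded_functional (l1 G) (l1_pair f)"
    unfolding bounded_functional_def l1_sel by blast
  then show ?thesis
    by (simp add: dual_def l1_pair_def)
qed

lemma dual_l1D:
  assumes "l \<in> carrier (dual (l1 G))"
  shows "\<And>a b. a \<in> carrier (l1 G) \<Longrightarrow> b \<in> carrier (l1 G) \<Longrightarrow> l (\<lambda>x. a x + b x) = l a + l b"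
    and "\<And>c a. a \<in> carrier (l1 G) \<Longrightarrow> l (\<lambda>x. c * a x) = c * l a"
    and "\<And>a. a \<notin> carrier (l1 G) \<Longrightarrow> l a = 0"
    and "\<exists>K. \<forall>a\<in>carrier (l1 G). cmod (l a) \<le> K * nrm (l1 G) a"
  using assms unfolding dual_def bounded_functional_def by simp_all

lemma zero_in_l1: "(\<lambda>x. 0) \<in> carrier (l1 G)"
  using l1_finite_closed [of "{}"] by simp

lemma nrm_l1_pair_le:
  assumes C: "\<And>x. x \<in> carrier G \<Longrightarrow> cmod (f x) \<le> C"
  shows "nrm (dual (l1 G)) (l1_pair f) \<le> C"
proof -
  have C0: "0 \<le> C" using C [OF one_closed] norm_ge_zero [of "f \<one>"] by linarith
  have "cmod (l1_pair f a) \<le> C" if "a \<in> carrier (l1 G)" "nrm (l1 G) a \<le> 1" for a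
  proof -
    have "cmod (l1_pair f a) \<le> C * nrm (l1 G) a"
      using that l1_pair_summable(3) [OF that(1) C] by (simp add: l1_pair_def)
    also have "\<dots> \<le> C * 1" using C0 that(2) by (rule mult_left_mono [rotated])
    finally show ?thesis by simp
  qed
  then show ?thesis
    using zero_in_l1 unfolding dual_def by (auto intro!: cSUP_least)
qed

text \<open>Point masses have norm 1. Together with \<open>nrm_l1_pair_le\<close> this makes
  \<open>l1_pair\<close> an isometry from bounded functions with the supremum norm to the
  dual.\<close>

lemma cmod_dual_point_le:
  assumes "l \<in> carrier (dual (l1 G))" "x \<in> carrier G"
  shows "cmod (l (point x)) \<le> nrm (dual (l1 G)) l"
proof -
  obtain K where K: "\<And>a. a \<in> carrier (l1 G) \<Longrightarrow> cmod (l a) \<le> K * nrm (l1 G) a"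
    using dual_l1D(4) [OF assms(1)] by blast
  have "cmod (l a) \<le> max K 0" if "a \<in> carrier (l1 G)" "nrm (l1 G) a \<le> 1" for a
  proof -
    have "0 \<le> nrm (l1 G) a" by (simp add: infsum_nonneg)
    then have "K * nrm (l1 G) a \<le> max K 0 * 1"
      using that(2) by (intro mult_mono) auto
    then show ?thesis using K [OF that(1)] by linarith
  qed
  \<comment> \<open>A real \<open>SUP\<close> is an upper bound only if the set is bounded above;
    the boundedness of \<open>l\<close> supplies this.\<close>
  then have "bdd_above ((\<lambda>a. cmod (l a)) ` {a \<in> carrier (l1 G). nrm (l1 G) a \<le> 1})"
    by (auto intro!: bdd_aboveI2)
  then show ?thesis
    using assms(2) nrm_point point_closed unfolding dual_def
    by (auto intro!: cSUP_upper2 simp del: l1_sel)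
qed

text \<open>On the restriction of \<open>a\<close> to a finite set \<open>F\<close> the formula is
  linearity. The error made by restricting is at most a constant times the tail of the norm of
  \<open>a\<close> outside \<open>F\<close>, which tends to 0 as \<open>F\<close> grows.\<close>

lemma dual_l1_eq_pair:
  assumes l: "l \<in> carrier (dual (l1 G))"
  shows "l = l1_pair (\<lambda>x. l (point x))"
proof
  fix a
  note ladd = dual_l1D(1) [OF l] and lsm = dual_l1D(2) [OF l]
  show "l a = l1_pair (\<lambda>x. l (point x)) a"
  proof (cases "a \<in> carrier (l1 G)")
    case False
    then show ?thesis using dual_l1D(3) [OF l] by (simp add: l1_pair_def)
  next
    case a: True
    obtain K where K: "\<And>a. a \<in> carrier (l1 G) \<Longrightarrow> cmod (l a) \<le> K * nrm (l1 G) a"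
      using dual_l1D(4) [OF l] by blast
    let ?r = "\<lambda>F x. if x \<in> F then a x else 0"
    let ?n = "\<lambda>x. cmod (a x)"
    have sm: "?n summable_on carrier G" using a by (simp add: l1_carrier_iff)
    have fin: "(\<Sum>x\<in>F. a x * l (point x)) = l (?r F)" if "finite F" "F \<subseteq> carrier G" for F
      using that
    proof (induction F rule: finite_induct)
      case empty
      show ?case using lsm [OF zero_in_l1, of 0] by simp
    next
      case (insert x F)
      have "?r (insert x F) = (\<lambda>y. a x * point x y + ?r F y)"
        using insert.hyps by (auto simp: point_def)
      then have "l (?r (insert x F)) = a x * l (point x) + l (?r F)"
        using insert.prems insert.hyps by (simp add: ladd lsm l1_smult_closed point_closed l1_finite_closed)
      then show ?case using insert by simp
    qed
    have "((\<lambda>F. l (?r F) - l a) \<longlongrightarrow> 0) (finite_subsets_at_top (carrier G))"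
    proof (rule Lim_null_comparison)
      have "cmod (l (?r F) - l a) \<le> K * ((\<Sum>\<^sub>\<infinity>x\<in>carrier G. ?n x) - sum ?n F)"
        if F: "finite F" "F \<subseteq> carrier G" for F
      proof -
        let ?s = "\<lambda>x. if x \<in> - F then a x else 0"
        have "a = (\<lambda>x. ?r F x + ?s x)" by auto
        then have "l a = l (?r F) + l ?s"
          using ladd [OF l1_restrict_closed [OF a] l1_restrict_closed [OF a], of F "- F"] by simp
        then have "cmod (l (?r F) - l a) = cmod (l ?s)" by simp
        also have "\<dots> \<le> K * nrm (l1 G) ?s" by (rule K [OF l1_restrict_closed [OF a]])
        also have "nrm (l1 G) ?s = (\<Sum>\<^sub>\<infinity>x\<in>carrier G - F. ?n x)"
          unfolding l1_sel by (rule infsum_cong_neutral) auto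
        also have "\<dots> = (\<Sum>\<^sub>\<infinity>x\<in>carrier G. ?n x) - sum ?n F"
          using infsum_Diff [OF sm, of F] F by simp
        finally show ?thesis .
      qed
      then show "\<forall>\<^sub>F F in finite_subsets_at_top (carrier G).
          cmod (l (?r F) - l a) \<le> K * ((\<Sum>\<^sub>\<infinity>x\<in>carrier G. ?n x) - sum ?n F)"
        by (auto intro: eventually_finite_subsets_at_top_weakI)
      have "((\<lambda>F. K * ((\<Sum>\<^sub>\<infinity>x\<in>carrier G. ?n x) - sum ?n F)) \<longlongrightarrow>
          K * ((\<Sum>\<^sub>\<infinity>x\<in>carrier G. ?n x) - (\<Sum>\<^sub>\<infinity>x\<in>carrier G. ?n x))) (finite_subsets_at_top (carrier G))"
        by (intro tendsto_intros infsum_tendsto sm)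
      then show "((\<lambda>F. K * ((\<Sum>\<^sub>\<infinity>x\<in>carrier G. ?n x) - sum ?n F)) \<longlongrightarrow> 0) (finite_subsets_at_top (carrier G))"
        by simp
    qed
    then have "((\<lambda>F. l (?r F)) \<longlongrightarrow> l a) (finite_subsets_at_top (carrier G))"
      by (simp add: LIM_zero_iff)
    then have "((\<lambda>F. \<Sum>x\<in>F. a x * l (point x)) \<longlongrightarrow> l a) (finite_subsets_at_top (carrier G))"
      by (rule Lim_transform_eventually) (auto intro!: eventually_finite_subsets_at_top_weakI simp: fin)
    then have "((\<lambda>x. a x * l (point x)) has_sum l a) (carrier G)"
      by (simp add: has_sum_def)
    then show ?thesis using a by (simp add: l1_pair_def infsumI)
  qed
qed

section \<open>Convolution on the group algebra\<close>

lemma l1_mult: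
  "a \<otimes>\<^bsub>l1 G\<^esub> b = (\<lambda>x. if x \<in> carrier G then \<Sum>\<^sub>\<infinity>y\<in>carrier G. a y * b (inv y \<otimes> x) else 0)"
  by (simp add: l1_def)

lemma bij_betw_left_mult: "y \<in> carrier G \<Longrightarrow> bij_betw (\<lambda>z. y \<otimes> z) (carrier G) (carrier G)"
  by (rule bij_betw_byWitness [where f' = "\<lambda>z. inv y \<otimes> z"]) (auto simp flip: m_assoc)

text \<open>Both claims are Fubini arguments. The family \<open>a y * b z\<close> is absolutely
  summable over pairs, and the shear that replaces \<open>z\<close> by
  \<open>inv y \<otimes> x\<close> carries this to the terms of the convolution. Multiplication by a
  bounded \<open>f\<close> keeps the family summable, so the order of summation may be
  exchanged.\<close>

lemma
  assumes a: "a \<in> carrier (l1 G)" and b: "b \<in> carrier (l1 G)"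
  shows l1_mult_closed: "a \<otimes>\<^bsub>l1 G\<^esub> b \<in> carrier (l1 G)"
    and l1_pair_mult: "bounded_fun f \<Longrightarrow>
      l1_pair f (a \<otimes>\<^bsub>l1 G\<^esub> b) = l1_pair (\<lambda>z. \<Sum>\<^sub>\<infinity>y\<in>carrier G. a y * f (y \<otimes> z)) b"
proof -
  let ?C = "carrier G"
  let ?P = "\<lambda>(y, z). a y * b z"
  let ?Q = "\<lambda>(y, x). a y * b (inv y \<otimes> x)"
  have sa: "(\<lambda>x. cmod (a x)) summable_on ?C" and sb: "(\<lambda>x. cmod (b x)) summable_on ?C"
    using a b by (auto simp: l1_carrier_iff)
  have P: "(\<lambda>p. cmod (?P p)) summable_on ?C \<times> ?C"
    unfolding Infinite_Sum.abs_summable_on_Sigma_iff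
    using sa sb by (auto simp: norm_mult infsum_cmult_right' infsum_nonneg abs_mult
        intro!: summable_on_cmult_right summable_on_cmult_left)
  have bij: "bij_betw (\<lambda>(y, x). (y, inv y \<otimes> x)) (?C \<times> ?C) (?C \<times> ?C)"
    by (rule bij_betw_byWitness [where f' = "\<lambda>(y, z). (y, y \<otimes> z)"]) (auto simp flip: m_assoc)
  have Q: "(\<lambda>p. cmod (?Q p)) summable_on ?C \<times> ?C"
    using P summable_on_reindex_bij_betw [OF bij, of "\<lambda>p. cmod (?P p)"]
    by (simp add: case_prod_unfold)
  have swap: "bij_betw (\<lambda>(x, y). (y, x)) (?C \<times> ?C) (?C \<times> ?C)"
    by (rule bij_betw_byWitness [where f' = "\<lambda>(x, y). (y, x)"]) auto
  have R: "(\<lambda>p. cmod ((\<lambda>(x, y). a y * b (inv y \<otimes> x)) p)) summable_on ?C \<times> ?C"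
    using Q summable_on_reindex_bij_betw [OF swap, of "\<lambda>p. cmod (?Q p)"]
    by (simp add: case_prod_unfold)
  then have R1: "\<And>x. x \<in> ?C \<Longrightarrow> (\<lambda>y. cmod (a y * b (inv y \<otimes> x))) summable_on ?C"
    and R2: "(\<lambda>x. norm (\<Sum>\<^sub>\<infinity>y\<in>?C. cmod (a y * b (inv y \<otimes> x)))) summable_on ?C"
    unfolding Infinite_Sum.abs_summable_on_Sigma_iff by auto
  have "(\<lambda>x. cmod (\<Sum>\<^sub>\<infinity>y\<in>?C. a y * b (inv y \<otimes> x))) summable_on ?C"
    by (rule Infinite_Sum.abs_summable_on_comparison_test [OF R2])
      (use norm_infsum_bound [OF R1] in \<open>simp add: infsum_nonneg\<close>)
  then have "(\<lambda>x. cmod (if x \<in> ?C then \<Sum>\<^sub>\<infinity>y\<in>?C. a y * b (inv y \<otimes> x) else 0)) summable_on ?C"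
    by (rule summable_on_cong [THEN iffD1, rotated]) auto
  then show cl: "a \<otimes>\<^bsub>l1 G\<^esub> b \<in> carrier (l1 G)"
    by (simp add: l1_carrier_iff l1_mult)
  assume "bounded_fun f"
  then obtain C where C: "\<And>x. x \<in> ?C \<Longrightarrow> cmod (f x) \<le> C"
    by (auto simp: bounded_fun_def)
  have mulC: "norm (h p * f x) \<le> norm (C * cmod (h p))" if "x \<in> ?C" for h :: "'a \<times> 'a \<Rightarrow> complex" and p x
    using mult_left_mono [OF C [OF that] norm_ge_zero [of "h p"]] order_trans [OF norm_ge_zero C [OF that]]
    by (simp add: norm_mult mult.commute abs_mult)
  have Rf: "(\<lambda>(x, y). a y * b (inv y \<otimes> x) * f x) summable_on ?C \<times> ?C"
  proof (rule abs_summable_summable,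
      rule Infinite_Sum.abs_summable_on_comparison_test [where g = "\<lambda>p. C * cmod ((\<lambda>(x, y). a y * b (inv y \<otimes> x)) p)"])
    show "(\<lambda>p. norm (C * cmod ((\<lambda>(x, y). a y * b (inv y \<otimes> x)) p))) summable_on ?C \<times> ?C"
      using summable_on_cmult_right [OF R, of "\<bar>C\<bar>"] by (simp add: abs_mult)
  qed (use mulC [where h = "\<lambda>(x, y). a y * b (inv y \<otimes> x)"] in auto)
  have Pf: "(\<lambda>(y, z). a y * b z * f (y \<otimes> z)) summable_on ?C \<times> ?C"
  proof (rule abs_summable_summable,
      rule Infinite_Sum.abs_summable_on_comparison_test [where g = "\<lambda>p. C * cmod (?P p)"])
    show "(\<lambda>p. norm (C * cmod (?P p))) summable_on ?C \<times> ?C"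
      using summable_on_cmult_right [OF P, of "\<bar>C\<bar>"] by (simp add: abs_mult)
  qed (use mulC [where h = ?P] in auto)
  have "l1_pair f (a \<otimes>\<^bsub>l1 G\<^esub> b) = (\<Sum>\<^sub>\<infinity>x\<in>?C. \<Sum>\<^sub>\<infinity>y\<in>?C. a y * b (inv y \<otimes> x) * f x)"
    using cl by (simp add: l1_pair_def l1_mult infsum_cmult_left' cong: infsum_cong)
  also have "\<dots> = (\<Sum>\<^sub>\<infinity>y\<in>?C. \<Sum>\<^sub>\<infinity>x\<in>?C. a y * b (inv y \<otimes> x) * f x)"
    by (rule infsum_swap_banach [OF Rf])
  also have "\<dots> = (\<Sum>\<^sub>\<infinity>y\<in>?C. \<Sum>\<^sub>\<infinity>z\<in>?C. a y * b z * f (y \<otimes> z))"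
  proof (rule infsum_cong)
    fix y assume y: "y \<in> ?C"
    show "(\<Sum>\<^sub>\<infinity>x\<in>?C. a y * b (inv y \<otimes> x) * f x) = (\<Sum>\<^sub>\<infinity>z\<in>?C. a y * b z * f (y \<otimes> z))"
      using y by (subst infsum_reindex_bij_betw [OF bij_betw_left_mult [OF y], symmetric])
        (simp add: m_assoc [symmetric] cong: infsum_cong)
  qed
  also have "\<dots> = (\<Sum>\<^sub>\<infinity>z\<in>?C. \<Sum>\<^sub>\<infinity>y\<in>?C. a y * b z * f (y \<otimes> z))"
    by (rule infsum_swap_banach [OF Pf])
  also have "\<dots> = (\<Sum>\<^sub>\<infinity>z\<in>?C. b z * (\<Sum>\<^sub>\<infinity>y\<in>?C. a y * f (y \<otimes> z)))"
    by (simp add: infsum_cmult_right' [symmetric] ac_simps)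
  finally show "l1_pair f (a \<otimes>\<^bsub>l1 G\<^esub> b) = l1_pair (\<lambda>z. \<Sum>\<^sub>\<infinity>y\<in>?C. a y * f (y \<otimes> z)) b"
    using b by (simp add: l1_pair_def)
qed

section \<open>The bidual of \<open>\<ell>\<^sup>1(G)\<close> as a ring\<close>

text \<open>
  The bidual of \<open>\<ell>\<^sup>1(G)\<close> is handled as the space of bounded functionals on bounded functions:
  \<open>pairing\<close> and \<open>bidual_of\<close> are mutually inverse. Only the values of a function on \<open>carrier G\<close>
  matter, so functions need not vanish off the carrier.
\<close>

definition pairing :: "((('a \<Rightarrow> complex) \<Rightarrow> complex) \<Rightarrow> complex) \<Rightarrow> ('a \<Rightarrow> complex) \<Rightarrow> complex" where
  "pairing \<Phi> f = \<Phi> (l1_pair f)"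

definition bounded_form :: "(('a \<Rightarrow> complex) \<Rightarrow> complex) \<Rightarrow> bool" where
  "bounded_form p \<longleftrightarrow>
     (\<forall>f g. bounded_fun f \<longrightarrow> bounded_fun g \<longrightarrow> p (\<lambda>x. f x + g x) = p f + p g) \<and>
     (\<forall>c f. bounded_fun f \<longrightarrow> p (\<lambda>x. c * f x) = c * p f) \<and>
     (\<exists>K. \<forall>f C. (\<forall>x\<in>carrier G. cmod (f x) \<le> C) \<longrightarrow> cmod (p f) \<le> K * C)"

definition bidual_of :: "(('a \<Rightarrow> complex) \<Rightarrow> complex) \<Rightarrow> (('a \<Rightarrow> complex) \<Rightarrow> complex) \<Rightarrow> complex" where
  "bidual_of p = (\<lambda>l. if l \<in> carrier (dual (l1 G)) then p (\<lambda>x. l (point x)) else 0)"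

lemma bounded_funI: "(\<And>x. x \<in> carrier G \<Longrightarrow> cmod (f x) \<le> C) \<Longrightarrow> bounded_fun f"
  by (auto simp: bounded_fun_def)

lemma bounded_fun_const [simp]: "bounded_fun (\<lambda>x. c)"
  by (auto simp: bounded_fun_def)

lemma bounded_fun_add: "bounded_fun f \<Longrightarrow> bounded_fun g \<Longrightarrow> bounded_fun (\<lambda>x. f x + g x)"
  unfolding bounded_fun_def by (meson add_mono norm_triangle_le)

lemma bounded_fun_mult: "bounded_fun f \<Longrightarrow> bounded_fun g \<Longrightarrow> bounded_fun (\<lambda>x. f x * g x)"
proof -
  assume "bounded_fun f" "bounded_fun g"
  then obtain C D where *: "\<And>x. x \<in> carrier G \<Longrightarrow> cmod (f x) \<le> C" "\<And>x. x \<in> carrier G \<Longrightarrow> cmod (g x) \<le> D"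
    by (auto simp: bounded_fun_def)
  show ?thesis
  proof (rule bounded_funI)
    fix x assume x: "x \<in> carrier G"
    show "cmod (f x * g x) \<le> C * D"
      using mult_mono [OF *(1) [OF x] *(2) [OF x] order_trans [OF norm_ge_zero *(1) [OF x]] norm_ge_zero]
      by (simp add: norm_mult)
  qed
qed

lemma bounded_fun_comp: "bounded_fun f \<Longrightarrow> (\<And>x. x \<in> carrier G \<Longrightarrow> h x \<in> carrier G) \<Longrightarrow> bounded_fun (\<lambda>x. f (h x))"
  by (auto simp: bounded_fun_def)

lemma bounded_fun_of_bool [simp]: "bounded_fun (\<lambda>x. of_bool (P x))"
  by (rule bounded_funI [of _ 1]) simp

lemma bounded_fun_dual: "l \<in> carrier (dual (l1 G)) \<Longrightarrow> bounded_fun (\<lambda>x. l (point x))"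
  by (blast intro: bounded_funI cmod_dual_point_le)

lemma bounded_formD:
  assumes "bounded_form p"
  shows "\<And>f g. bounded_fun f \<Longrightarrow> bounded_fun g \<Longrightarrow> p (\<lambda>x. f x + g x) = p f + p g"
    and "\<And>c f. bounded_fun f \<Longrightarrow> p (\<lambda>x. c * f x) = c * p f"
    and "\<exists>K\<ge>0. \<forall>f C. (\<forall>x\<in>carrier G. cmod (f x) \<le> C) \<longrightarrow> cmod (p f) \<le> K * C"
proof -
  show "\<And>f g. bounded_fun f \<Longrightarrow> bounded_fun g \<Longrightarrow> p (\<lambda>x. f x + g x) = p f + p g"
    and "\<And>c f. bounded_fun f \<Longrightarrow> p (\<lambda>x. c * f x) = c * p f"
    using assms by (simp_all add: bounded_form_def)
  obtain K where K: "\<And>f C. (\<forall>x\<in>carrier G. cmod (f x) \<le> C) \<Longrightarrow> cmod (p f) \<le> K * C"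
    using assms by (auto simp: bounded_form_def)
  \<comment> \<open>A pointwise bound \<open>C\<close> is non-negative because the carrier contains
    \<open>\<one>\<close>, so \<open>K\<close> may be enlarged to a non-negative constant.\<close>
  have "cmod (p f) \<le> max K 0 * C" if "\<forall>x\<in>carrier G. cmod (f x) \<le> C" for f C
  proof -
    have "0 \<le> C" using that one_closed norm_ge_zero order_trans by blast
    then have "K * C \<le> max K 0 * C" by (intro mult_right_mono) auto
    then show ?thesis using K [OF that] by linarith
  qed
  then show "\<exists>K\<ge>0. \<forall>f C. (\<forall>x\<in>carrier G. cmod (f x) \<le> C) \<longrightarrow> cmod (p f) \<le> K * C"
    by (intro exI [of _ "max K 0"]) auto
qed

lemma bounded_form_diff:
  "bounded_form p \<Longrightarrow> bounded_fun f \<Longrightarrow> bounded_fun g \<Longrightarrow> p (\<lambda>x. f x - g x) = p f - p g"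
  using bounded_formD(1) [of p f "\<lambda>x. - 1 * g x"] bounded_formD(2) [of p g "- 1"]
    bounded_fun_mult [of "\<lambda>x. - 1" g] by simp

lemma bounded_form_zero: "bounded_form p \<Longrightarrow> p (\<lambda>x. 0) = 0"
  using bounded_formD(2) [of p "\<lambda>x. 0" 0] by simp

text \<open>The difference \<open>f x - g x\<close> is bounded on the carrier by
  \<open>C = 0\<close>, and the norm estimate then forces its value under \<open>p\<close> to be
  0.\<close>

lemma bounded_form_cong:
  assumes "bounded_form p" "bounded_fun f" "\<And>x. x \<in> carrier G \<Longrightarrow> f x = g x"
  shows "p f = p g"
proof -
  have g: "bounded_fun g" using assms(2,3) by (auto simp: bounded_fun_def)
  obtain K where "\<forall>f C. (\<forall>x\<in>carrier G. cmod (f x) \<le> C) \<longrightarrow> cmod (p f) \<le> K * C"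
    using bounded_formD(3) [OF assms(1)] by blast
  from this [rule_format, of "\<lambda>x. f x - g x" 0] have "p (\<lambda>x. f x - g x) = 0"
    using assms(3) by simp
  then show ?thesis using bounded_form_diff [OF assms(1,2) g] by simp
qed

lemma l1_pair_cong: "(\<And>x. x \<in> carrier G \<Longrightarrow> f x = g x) \<Longrightarrow> l1_pair f = l1_pair g"
  by (auto simp: l1_pair_def fun_eq_iff intro: infsum_cong)

lemma pairing_cong: "(\<And>x. x \<in> carrier G \<Longrightarrow> f x = g x) \<Longrightarrow> pairing \<Phi> f = pairing \<Phi> g"
  unfolding pairing_def by (metis l1_pair_cong)

lemma dual_sel [simp]:
  "l \<oplus>\<^bsub>dual A\<^esub> l' = (\<lambda>x. l x + l' x)" "c \<odot>\<^bsub>dual A\<^esub> l = (\<lambda>x. c * l x)"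
  by (simp_all add: dual_def)

lemma bidual_sel [simp]:
  "carrier (bidual (l1 G)) = carrier (dual (dual (l1 G)))"
  "\<Phi> \<otimes>\<^bsub>bidual (l1 G)\<^esub> \<Psi> = arens (l1 G) \<Phi> \<Psi>"
  "\<Phi> \<oplus>\<^bsub>bidual (l1 G)\<^esub> \<Psi> = (\<lambda>l. \<Phi> l + \<Psi> l)"
  "\<zero>\<^bsub>bidual (l1 G)\<^esub> = (\<lambda>l. 0)"
  by (simp_all add: bidual_def dual_def)

lemma in_bidual_iff:
  "\<Phi> \<in> carrier (bidual (l1 G)) \<longleftrightarrow>
     bounded_functional (dual (l1 G)) \<Phi> \<and> (\<forall>l. l \<notin> carrier (dual (l1 G)) \<longrightarrow> \<Phi> l = 0)"
  by (simp add: dual_def [of "dual (l1 G)"])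

lemma l1_pair_add:
  assumes "bounded_fun f" "bounded_fun g"
  shows "l1_pair (\<lambda>x. f x + g x) = (\<lambda>a. l1_pair f a + l1_pair g a)"
proof
  fix a
  obtain C D where *: "\<And>x. x \<in> carrier G \<Longrightarrow> cmod (f x) \<le> C" "\<And>x. x \<in> carrier G \<Longrightarrow> cmod (g x) \<le> D"
    using assms by (auto simp: bounded_fun_def)
  show "l1_pair (\<lambda>x. f x + g x) a = l1_pair f a + l1_pair g a"
    using infsum_add [OF l1_pair_summable(2) [OF _ *(1), of a] l1_pair_summable(2) [OF _ *(2), of a]]
    by (simp add: l1_pair_def distrib_left)
qed

lemma l1_pair_smult: "l1_pair (\<lambda>x. c * f x) = (\<lambda>a. c * l1_pair f a)"
  by (auto simp: l1_pair_def fun_eq_iff mult.left_commute infsum_cmult_right')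

lemma bounded_form_pairing:
  assumes "\<Phi> \<in> carrier (bidual (l1 G))"
  shows "bounded_form (pairing \<Phi>)"
proof -
  have *: "bounded_functional (dual (l1 G)) \<Phi>" using assms by (simp only: in_bidual_iff)
  then obtain K where K: "\<And>l. l \<in> carrier (dual (l1 G)) \<Longrightarrow> cmod (\<Phi> l) \<le> K * nrm (dual (l1 G)) l"
    unfolding bounded_functional_def by blast
  have "cmod (pairing \<Phi> f) \<le> max K 0 * C" if C: "\<forall>x\<in>carrier G. cmod (f x) \<le> C" for f C
  proof -
    have "bounded_fun f" using C by (auto simp: bounded_fun_def)
    then have f: "l1_pair f \<in> carrier (dual (l1 G))" by (rule l1_pair_in_dual)
    have n0: "0 \<le> nrm (dual (l1 G)) (l1_pair f)"
      using cmod_dual_point_le [OF f one_closed] norm_ge_zero order_trans by blast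
    have "cmod (pairing \<Phi> f) \<le> K * nrm (dual (l1 G)) (l1_pair f)"
      using K [OF f] by (simp add: pairing_def)
    also have "\<dots> \<le> max K 0 * C"
      using n0 nrm_l1_pair_le [of f C] C by (intro mult_mono) auto
    finally show ?thesis .
  qed
  then have "\<exists>K. \<forall>f C. (\<forall>x\<in>carrier G. cmod (f x) \<le> C) \<longrightarrow> cmod (pairing \<Phi> f) \<le> K * C" by blast
  then show ?thesis
    using * unfolding bounded_form_def pairing_def bounded_functional_def dual_sel
    by (simp add: l1_pair_add l1_pair_smult l1_pair_in_dual)
qed

lemma dual_l1_add:
  assumes "l \<in> carrier (dual (l1 G))" "l' \<in> carrier (dual (l1 G))"
  shows "(\<lambda>a. l a + l' a) \<in> carrier (dual (l1 G))"
proof -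
  have "(\<lambda>a. l a + l' a) = l1_pair (\<lambda>x. l (point x) + l' (point x))"
    using assms by (simp add: l1_pair_add bounded_fun_dual flip: dual_l1_eq_pair)
  then show ?thesis using assms by (simp add: l1_pair_in_dual bounded_fun_add bounded_fun_dual)
qed

lemma dual_l1_smult:
  assumes "l \<in> carrier (dual (l1 G))"
  shows "(\<lambda>a. c * l a) \<in> carrier (dual (l1 G))"
proof -
  have "(\<lambda>a. c * l a) = l1_pair (\<lambda>x. c * l (point x))"
    using assms by (simp add: l1_pair_smult flip: dual_l1_eq_pair)
  then show ?thesis using assms by (simp add: l1_pair_in_dual bounded_fun_mult bounded_fun_dual)
qed

lemma bidual_of_closed:
  assumes p: "bounded_form p"
  shows "bidual_of p \<in> carrier (bidual (l1 G))"
proof -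
  obtain K where K: "\<And>f C. (\<forall>x\<in>carrier G. cmod (f x) \<le> C) \<Longrightarrow> cmod (p f) \<le> K * C"
    using bounded_formD(3) [OF p] by blast
  have "cmod (bidual_of p l) \<le> K * nrm (dual (l1 G)) l" if "l \<in> carrier (dual (l1 G))" for l
    using that K cmod_dual_point_le [OF that] by (simp add: bidual_of_def)
  moreover have "bidual_of p (\<lambda>x. l x + l' x) = bidual_of p l + bidual_of p l'"
    if "l \<in> carrier (dual (l1 G))" "l' \<in> carrier (dual (l1 G))" for l l'
    using that by (simp add: bidual_of_def dual_l1_add bounded_formD(1) [OF p] bounded_fun_dual)
  moreover have "bidual_of p (\<lambda>x. c * l x) = c * bidual_of p l"
    if "l \<in> carrier (dual (l1 G))" for c l
    using that by (simp add: bidual_of_def dual_l1_smult bounded_formD(2) [OF p] bounded_fun_dual)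
  ultimately have "bounded_functional (dual (l1 G)) (bidual_of p)"
    unfolding bounded_functional_def dual_sel by blast
  then show ?thesis unfolding in_bidual_iff by (simp add: bidual_of_def)
qed

lemma pairing_bidual_of:
  assumes "bounded_form p" "bounded_fun f"
  shows "pairing (bidual_of p) f = p f"
  using bounded_form_cong [OF assms, of "\<lambda>x. l1_pair f (point x)"] l1_pair_in_dual [OF assms(2)]
  by (simp add: pairing_def bidual_of_def l1_pair_point)

text \<open>Every element of the dual is \<open>l1_pair\<close> of a bounded function, so pairings
  with bounded functions separate the bidual. Identities in the bidual are verified in this way from
  here on.\<close>

lemma bidual_eqI:
  assumes "\<Phi> \<in> carrier (bidual (l1 G))" "\<Psi> \<in> carrier (bidual (l1 G))"
    and "\<And>f. bounded_fun f \<Longrightarrow> pairing \<Phi> f = pairing \<Psi> f"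
  shows "\<Phi> = \<Psi>"
proof
  fix l
  show "\<Phi> l = \<Psi> l"
  proof (cases "l \<in> carrier (dual (l1 G))")
    case True
    then show ?thesis
      using assms(3) [OF bounded_fun_dual [OF True]] by (simp add: pairing_def flip: dual_l1_eq_pair)
  next
    case False
    then show ?thesis using assms(1,2) unfolding in_bidual_iff by simp
  qed
qed

lemma bounded_form_add: "bounded_form p \<Longrightarrow> bounded_form q \<Longrightarrow> bounded_form (\<lambda>f. p f + q f)"
proof -
  assume p: "bounded_form p" and q: "bounded_form q"
  obtain K L where K: "\<And>f C. (\<forall>x\<in>carrier G. cmod (f x) \<le> C) \<Longrightarrow> cmod (p f) \<le> K * C"
    and L: "\<And>f C. (\<forall>x\<in>carrier G. cmod (f x) \<le> C) \<Longrightarrow> cmod (q f) \<le> L * C"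
    using bounded_formD(3) [OF p] bounded_formD(3) [OF q] by blast
  have "cmod (p f + q f) \<le> (K + L) * C" if "\<forall>x\<in>carrier G. cmod (f x) \<le> C" for f C
    using norm_triangle_le [of "p f" "q f"] K [OF that] L [OF that] by (simp add: distrib_right)
  then have "\<exists>K. \<forall>f C. (\<forall>x\<in>carrier G. cmod (f x) \<le> C) \<longrightarrow> cmod (p f + q f) \<le> K * C"
    by blast
  then show ?thesis
    using bounded_formD(1,2) [OF p] bounded_formD(1,2) [OF q]
    by (simp add: bounded_form_def distrib_left)
qed

lemma bounded_form_smult: "bounded_form p \<Longrightarrow> bounded_form (\<lambda>f. c * p f)"
proof -
  assume p: "bounded_form p"
  obtain K where K: "\<And>f C. (\<forall>x\<in>carrier G. cmod (f x) \<le> C) \<Longrightarrow> cmod (p f) \<le> K * C"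
    using bounded_formD(3) [OF p] by blast
  have "cmod (c * p f) \<le> (cmod c * K) * C" if "\<forall>x\<in>carrier G. cmod (f x) \<le> C" for f C
    using mult_left_mono [OF K [OF that], of "cmod c"] by (simp add: norm_mult mult.assoc)
  then have "\<exists>K. \<forall>f C. (\<forall>x\<in>carrier G. cmod (f x) \<le> C) \<longrightarrow> cmod (c * p f) \<le> K * C"
    by blast
  then show ?thesis
    using bounded_formD(1,2) [OF p] by (simp add: bounded_form_def distrib_left)
qed

text \<open>The source of new functionals: convolutions, restrictions to cosets and averages all
  arise by composing a form with a bounded linear operator \<open>T\<close>. The conditions on
  \<open>T\<close> concern values on the carrier only, since \<open>p\<close> sees nothing
  else.\<close>

lemma bounded_form_comp:
  assumes p: "bounded_form p"
    and add: "\<And>f g x. bounded_fun f \<Longrightarrow> bounded_fun g \<Longrightarrow> x \<in> carrier G \<Longrightarrow> T (\<lambda>x. f x + g x) x = T f x + T g x"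
    and sm: "\<And>c f x. bounded_fun f \<Longrightarrow> x \<in> carrier G \<Longrightarrow> T (\<lambda>x. c * f x) x = c * T f x"
    and bd: "\<And>f C x. (\<forall>x\<in>carrier G. cmod (f x) \<le> C) \<Longrightarrow> x \<in> carrier G \<Longrightarrow> cmod (T f x) \<le> L * C"
  shows "bounded_form (\<lambda>f. p (T f))"
proof -
  obtain K where K: "\<And>f C. (\<forall>x\<in>carrier G. cmod (f x) \<le> C) \<Longrightarrow> cmod (p f) \<le> K * C"
    using bounded_formD(3) [OF p] by blast
  have T: "bounded_fun (T f)" if "bounded_fun f" for f
    using that bd unfolding bounded_fun_def by meson
  have "p (T (\<lambda>x. f x + g x)) = p (T f) + p (T g)" if "bounded_fun f" "bounded_fun g" for f g
    using bounded_form_cong [OF p T [OF bounded_fun_add [OF that]], of "\<lambda>x. T f x + T g x"]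
      bounded_formD(1) [OF p T [OF that(1)] T [OF that(2)]] add that by simp
  moreover have "p (T (\<lambda>x. c * f x)) = c * p (T f)" if "bounded_fun f" for c f
    using bounded_form_cong [OF p T [OF bounded_fun_mult [of "\<lambda>x. c", OF _ that]], of "\<lambda>x. c * T f x"]
      bounded_formD(2) [OF p T [OF that]] sm that by simp
  moreover have "cmod (p (T f)) \<le> (K * L) * C" if "\<forall>x\<in>carrier G. cmod (f x) \<le> C" for f C
    using K [of "T f" "L * C"] bd that by (simp add: mult.assoc)
  ultimately show ?thesis unfolding bounded_form_def by blast
qed

lemma bounded_fun_translates:
  assumes "bounded_form p" "bounded_fun f"
  shows "bounded_fun (\<lambda>x. p (\<lambda>y. f (x \<otimes> y)))"
proof -
  obtain K where K: "\<And>f C. (\<forall>x\<in>carrier G. cmod (f x) \<le> C) \<Longrightarrow> cmod (p f) \<le> K * C"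
    using bounded_formD(3) [OF assms(1)] by blast
  obtain C where C: "\<And>x. x \<in> carrier G \<Longrightarrow> cmod (f x) \<le> C"
    using assms(2) by (auto simp: bounded_fun_def)
  show ?thesis by (rule bounded_funI [of _ "K * C"]) (auto intro!: K C)
qed

lemma bounded_fun_translate:
  "bounded_fun f \<Longrightarrow> x \<in> carrier G \<Longrightarrow> bounded_fun (\<lambda>y. f (x \<otimes> y))"
  by (rule bounded_fun_comp) auto

lemma bounded_form_convolution:
  assumes p: "bounded_form p" and q: "bounded_form q"
  shows "bounded_form (\<lambda>f. p (\<lambda>x. q (\<lambda>y. f (x \<otimes> y))))"
proof -
  obtain K where K: "\<And>f C. (\<forall>x\<in>carrier G. cmod (f x) \<le> C) \<Longrightarrow> cmod (q f) \<le> K * C"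
    using bounded_formD(3) [OF q] by blast
  show ?thesis
    by (rule bounded_form_comp [OF p, where T = "\<lambda>f x. q (\<lambda>y. f (x \<otimes> y))" and L = K])
      (auto simp: bounded_formD(1,2) [OF q] bounded_fun_translate intro!: K)
qed

section \<open>The Arens product on bounded functions\<close>

lemma dual_act_l1_pair:
  assumes "bounded_fun f" "a \<in> carrier (l1 G)"
  shows "dual_act (l1 G) (l1_pair f) a = l1_pair (\<lambda>z. \<Sum>\<^sub>\<infinity>y\<in>carrier G. a y * f (y \<otimes> z))"
  using l1_pair_mult [OF assms(2) _ assms(1)]
  by (auto simp: dual_act_def fun_eq_iff) (simp add: l1_pair_def)

text \<open>The left side sends \<open>a\<close> to the pairing of \<open>\<Phi>\<close> with the
  function of \<open>z\<close> that sums \<open>a y * f (y \<otimes> z)\<close> over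
  \<open>y\<close>. This is a bounded functional of \<open>a\<close>, hence determined by its values
  at point masses, where the sum collapses to \<open>f (x \<otimes> z)\<close>.\<close>

lemma bidual_act_l1_pair:
  assumes \<Phi>: "\<Phi> \<in> carrier (bidual (l1 G))" and f: "bounded_fun f"
  shows "bidual_act (l1 G) \<Phi> (l1_pair f) = l1_pair (\<lambda>x. pairing \<Phi> (\<lambda>y. f (x \<otimes> y)))"
proof -
  let ?h = "\<lambda>a z. \<Sum>\<^sub>\<infinity>y\<in>carrier G. a y * f (y \<otimes> z)"
  let ?l = "bidual_act (l1 G) \<Phi> (l1_pair f)"
  note p = bounded_form_pairing [OF \<Phi>]
  obtain C where C: "\<And>x. x \<in> carrier G \<Longrightarrow> cmod (f x) \<le> C"
    using f by (auto simp: bounded_fun_def)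
  obtain K where K: "\<And>f C. (\<forall>x\<in>carrier G. cmod (f x) \<le> C) \<Longrightarrow> cmod (pairing \<Phi> f) \<le> K * C"
    using bounded_formD(3) [OF p] by blast
  have eq: "?l a = pairing \<Phi> (?h a)" if "a \<in> carrier (l1 G)" for a
    using that by (simp add: bidual_act_def dual_act_l1_pair [OF f] pairing_def)
  have hle: "cmod (?h a z) \<le> C * nrm (l1 G) a" if "a \<in> carrier (l1 G)" "z \<in> carrier G" for a z
    using that C by (intro l1_pair_summable(3)) auto
  have hs: "(\<lambda>y. a y * f (y \<otimes> z)) summable_on carrier G" if "a \<in> carrier (l1 G)" "z \<in> carrier G" for a z
    using that C by (intro l1_pair_summable(2)) auto
  have hb: "bounded_fun (?h a)" if "a \<in> carrier (l1 G)" for a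
    using hle [OF that] by (rule bounded_funI)
  have "?l (\<lambda>x. a x + b x) = ?l a + ?l b" if ab: "a \<in> carrier (l1 G)" "b \<in> carrier (l1 G)" for a b
  proof -
    have "pairing \<Phi> (?h (\<lambda>x. a x + b x)) = pairing \<Phi> (\<lambda>z. ?h a z + ?h b z)"
      by (rule pairing_cong) (simp add: distrib_right infsum_add hs ab)
    then show ?thesis
      using ab by (simp add: eq l1_add_closed bounded_formD(1) [OF p] hb)
  qed
  moreover have "?l (\<lambda>x. c * a x) = c * ?l a" if a: "a \<in> carrier (l1 G)" for c a
  proof -
    have "pairing \<Phi> (?h (\<lambda>x. c * a x)) = pairing \<Phi> (\<lambda>z. c * ?h a z)"
      by (rule pairing_cong) (simp add: mult.assoc infsum_cmult_right')
    then show ?thesis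
      using a by (simp add: eq l1_smult_closed bounded_formD(2) [OF p] hb)
  qed
  moreover have "cmod (?l a) \<le> (K * C) * nrm (l1 G) a" if a: "a \<in> carrier (l1 G)" for a
    using K [of "?h a" "C * nrm (l1 G) a"] hle [OF a] by (simp add: eq [OF a] mult.assoc)
  ultimately have "bounded_functional (l1 G) ?l"
    unfolding bounded_functional_def l1_sel(1,2) by blast
  then have l: "?l \<in> carrier (dual (l1 G))"
    by (simp add: dual_def bidual_act_def)
  show ?thesis
  proof (subst dual_l1_eq_pair [OF l], rule l1_pair_cong)
    fix x assume x: "x \<in> carrier G"
    show "?l (point x) = pairing \<Phi> (\<lambda>y. f (x \<otimes> y))"
      unfolding eq [OF point_closed [OF x]]
      by (rule pairing_cong) (simp add: infsum_point [OF x])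
  qed
qed

text \<open>The first Arens product as an iterated integral: the right factor integrates the inner
  variable \<open>y\<close> for each fixed \<open>x\<close>, then the left factor integrates
  \<open>x\<close>. The order matters, since finitely additive functionals do not satisfy
  Fubini.\<close>

lemma arens_eq:
  assumes "\<Psi> \<in> carrier (bidual (l1 G))" "\<Phi> \<in> carrier (bidual (l1 G))"
  shows "arens (l1 G) \<Psi> \<Phi> = bidual_of (\<lambda>f. pairing \<Psi> (\<lambda>x. pairing \<Phi> (\<lambda>y. f (x \<otimes> y))))"
proof
  fix l
  show "arens (l1 G) \<Psi> \<Phi> l = bidual_of (\<lambda>f. pairing \<Psi> (\<lambda>x. pairing \<Phi> (\<lambda>y. f (x \<otimes> y)))) l"
  proof (cases "l \<in> carrier (dual (l1 G))")
    case True
    then have "bidual_act (l1 G) \<Phi> l = l1_pair (\<lambda>x. pairing \<Phi> (\<lambda>y. l (point (x \<otimes> y))))"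
      using bidual_act_l1_pair [OF assms(2) bounded_fun_dual [OF True]] by (simp flip: dual_l1_eq_pair)
    then show ?thesis using True by (simp add: arens_def bidual_of_def pairing_def [of \<Psi>])
  qed (simp add: arens_def bidual_of_def)
qed

section \<open>Ring structure of the bidual\<close>

lemma bidual_mult_closed:
  "\<Psi> \<in> carrier (bidual (l1 G)) \<Longrightarrow> \<Phi> \<in> carrier (bidual (l1 G)) \<Longrightarrow>
     \<Psi> \<otimes>\<^bsub>bidual (l1 G)\<^esub> \<Phi> \<in> carrier (bidual (l1 G))"
  unfolding bidual_sel(2)
  by (subst arens_eq) (blast intro: bidual_of_closed bounded_form_convolution bounded_form_pairing)+

lemma pairing_mult:
  "\<Psi> \<in> carrier (bidual (l1 G)) \<Longrightarrow> \<Phi> \<in> carrier (bidual (l1 G)) \<Longrightarrow> bounded_fun f \<Longrightarrow>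
     pairing (\<Psi> \<otimes>\<^bsub>bidual (l1 G)\<^esub> \<Phi>) f = pairing \<Psi> (\<lambda>x. pairing \<Phi> (\<lambda>y. f (x \<otimes> y)))"
  unfolding bidual_sel(2)
  by (subst arens_eq) (auto intro: pairing_bidual_of bounded_form_convolution bounded_form_pairing simp del: bidual_sel(1))

lemma pairing_add: "pairing (\<Phi> \<oplus>\<^bsub>bidual (l1 G)\<^esub> \<Psi>) f = pairing \<Phi> f + pairing \<Psi> f"
  by (simp add: pairing_def)

lemma pairing_zero: "pairing \<zero>\<^bsub>bidual (l1 G)\<^esub> f = 0"
  by (simp add: pairing_def)

lemma bounded_form_eval: "g \<in> carrier G \<Longrightarrow> bounded_form (\<lambda>f. f g)"
  unfolding bounded_form_def by (auto intro!: exI [of _ 1])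

lemma bounded_form_null: "bounded_form (\<lambda>f. 0)"
  unfolding bounded_form_def by (auto intro!: exI [of _ 0])

lemma bidual_one: "\<one>\<^bsub>bidual (l1 G)\<^esub> = bidual_of (\<lambda>f. f \<one>)"
  by (simp add: bidual_def bidual_of_def cong: if_cong)

lemma bidual_of_pairing:
  "\<Phi> \<in> carrier (bidual (l1 G)) \<Longrightarrow> bidual_of (pairing \<Phi>) = \<Phi>"
  by (rule bidual_eqI) (simp_all add: bidual_of_closed bounded_form_pairing pairing_bidual_of del: bidual_sel)

lemma bidual_add_eq:
  "\<Phi> \<in> carrier (bidual (l1 G)) \<Longrightarrow> \<Psi> \<in> carrier (bidual (l1 G)) \<Longrightarrow>
     \<Phi> \<oplus>\<^bsub>bidual (l1 G)\<^esub> \<Psi> = bidual_of (\<lambda>f. pairing \<Phi> f + pairing \<Psi> f)"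
  using bidual_of_pairing [of \<Phi>] bidual_of_pairing [of \<Psi>]
  unfolding bidual_sel(3) fun_eq_iff bidual_of_def by (metis add_0)

lemma bidual_add_closed:
  "\<Phi> \<in> carrier (bidual (l1 G)) \<Longrightarrow> \<Psi> \<in> carrier (bidual (l1 G)) \<Longrightarrow>
     \<Phi> \<oplus>\<^bsub>bidual (l1 G)\<^esub> \<Psi> \<in> carrier (bidual (l1 G))"
  by (simp add: bidual_add_eq bidual_of_closed bounded_form_add bounded_form_pairing del: bidual_sel)

lemma bidual_zero_closed: "\<zero>\<^bsub>bidual (l1 G)\<^esub> \<in> carrier (bidual (l1 G))"
  using bidual_of_closed [OF bounded_form_null] by (simp add: bidual_of_def cong: if_cong)

lemma bidual_one_closed: "\<one>\<^bsub>bidual (l1 G)\<^esub> \<in> carrier (bidual (l1 G))"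
  unfolding bidual_one by (rule bidual_of_closed [OF bounded_form_eval [OF one_closed]])

lemma pairing_one: "bounded_fun f \<Longrightarrow> pairing \<one>\<^bsub>bidual (l1 G)\<^esub> f = f \<one>"
  unfolding bidual_one by (rule pairing_bidual_of [OF bounded_form_eval [OF one_closed]])

lemma bounded_fun_pairing:
  "\<Phi> \<in> carrier (bidual (l1 G)) \<Longrightarrow> bounded_fun f \<Longrightarrow> bounded_fun (\<lambda>x. pairing \<Phi> (\<lambda>y. f (x \<otimes> y)))"
  by (rule bounded_fun_translates [OF bounded_form_pairing])

lemmas bidual_closed = bidual_mult_closed bidual_add_closed bidual_zero_closed bidual_one_closed

text \<open>All axioms are tested on bounded functions. Associativity is inherited from
  \<open>G\<close>, and distributivity over a sum in the right factor is linearity of the left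
  factor.\<close>

theorem ring_bidual: "ring (bidual (l1 G))"
proof (rule ringI)
  note [simp del] = bidual_sel
  note [simp] = bidual_closed pairing_add pairing_mult pairing_zero pairing_one bounded_fun_pairing
    bounded_fun_translate
  let ?B = "bidual (l1 G)"
  show "abelian_group ?B"
  proof (rule abelian_groupI)
    fix x assume x: "x \<in> carrier ?B"
    show "\<exists>y\<in>carrier ?B. y \<oplus>\<^bsub>?B\<^esub> x = \<zero>\<^bsub>?B\<^esub>"
    proof
      let ?y = "bidual_of (\<lambda>f. - 1 * pairing x f)"
      have b: "bounded_form (\<lambda>f. - 1 * pairing x f)"
        by (rule bounded_form_smult [OF bounded_form_pairing [OF x]])
      show y: "?y \<in> carrier ?B" by (rule bidual_of_closed [OF b])
      show "?y \<oplus>\<^bsub>?B\<^esub> x = \<zero>\<^bsub>?B\<^esub>"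
        by (rule bidual_eqI) (use x y pairing_bidual_of [OF b] in simp_all)
    qed
  qed (auto intro!: bidual_eqI)
  show "monoid ?B"
  proof (rule monoidI)
    fix x y z assume [simp]: "x \<in> carrier ?B" "y \<in> carrier ?B" "z \<in> carrier ?B"
    show "x \<otimes>\<^bsub>?B\<^esub> y \<otimes>\<^bsub>?B\<^esub> z = x \<otimes>\<^bsub>?B\<^esub> (y \<otimes>\<^bsub>?B\<^esub> z)"
    proof (rule bidual_eqI)
      fix f assume [simp]: "bounded_fun f"
      show "pairing (x \<otimes>\<^bsub>?B\<^esub> y \<otimes>\<^bsub>?B\<^esub> z) f = pairing (x \<otimes>\<^bsub>?B\<^esub> (y \<otimes>\<^bsub>?B\<^esub> z)) f"
        by simp (intro pairing_cong, simp add: m_assoc cong: pairing_cong)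
    qed simp_all
  next
    fix x assume [simp]: "x \<in> carrier ?B"
    show "\<one>\<^bsub>?B\<^esub> \<otimes>\<^bsub>?B\<^esub> x = x"
      by (rule bidual_eqI) (auto intro: pairing_cong)
    show "x \<otimes>\<^bsub>?B\<^esub> \<one>\<^bsub>?B\<^esub> = x"
      by (rule bidual_eqI) (auto intro: pairing_cong)
  qed simp_all
  fix x y z assume [simp]: "x \<in> carrier ?B" "y \<in> carrier ?B" "z \<in> carrier ?B"
  show "(x \<oplus>\<^bsub>?B\<^esub> y) \<otimes>\<^bsub>?B\<^esub> z = x \<otimes>\<^bsub>?B\<^esub> z \<oplus>\<^bsub>?B\<^esub> y \<otimes>\<^bsub>?B\<^esub> z"
    by (rule bidual_eqI) simp_all
  show "z \<otimes>\<^bsub>?B\<^esub> (x \<oplus>\<^bsub>?B\<^esub> y) = z \<otimes>\<^bsub>?B\<^esub> x \<oplus>\<^bsub>?B\<^esub> z \<otimes>\<^bsub>?B\<^esub> y"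
    by (rule bidual_eqI) (simp_all add: bounded_formD(1) [OF bounded_form_pairing])
qed

end

section \<open>Radical elements from normal subgroups\<close>

lemma (in group) rcosets_transversal:
  assumes N: "subgroup N G" and fin: "finite (rcosets N)"
  obtains T where "finite T" "T \<subseteq> carrier G"
    "\<And>x. x \<in> carrier G \<Longrightarrow> \<exists>t\<in>T. x \<in> N #> t"
    "\<And>x s t. \<lbrakk>s \<in> T; t \<in> T; x \<in> N #> s; x \<in> N #> t\<rbrakk> \<Longrightarrow> s = t"
proof
  define rep where "rep = (\<lambda>c :: 'a set. SOME x. x \<in> c)"
  have rep: "rep c \<in> c \<and> rep c \<in> carrier G \<and> N #> rep c = c" if c: "c \<in> rcosets N" for c
  proof -
    obtain a where a: "a \<in> carrier G" "c = N #> a" using c by (auto simp: RCOSETS_def)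
    then have "a \<in> c" using rcos_self [OF a(1) N] by simp
    then have r: "rep c \<in> c" unfolding rep_def by (rule someI)
    then show ?thesis
      using a repr_independence [OF _ a(1) N, of "rep c"] r_coset_subset_G [OF subgroup.subset [OF N] a(1)]
      by auto
  qed
  show "finite (rep ` (rcosets N))" using fin by simp
  show "rep ` (rcosets N) \<subseteq> carrier G" using rep by blast
  show "\<exists>t\<in>rep ` (rcosets N). x \<in> N #> t" if "x \<in> carrier G" for x
    using rep rcosetsI [OF subgroup.subset [OF N] that] rcos_self [OF that N] by (metis imageI)
  show "s = t" if st: "s \<in> rep ` (rcosets N)" "t \<in> rep ` (rcosets N)" and x: "x \<in> N #> s" "x \<in> N #> t" for x s t
  proof -
    obtain c d where cd: "c \<in> rcosets N" "s = rep c" "d \<in> rcosets N" "t = rep d" using st by blast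
    then have "x \<in> c" "x \<in> d" using rep x by auto
    then have "c = d" using rcos_disjoint [OF N] cd by (auto simp: pairwise_def disjnt_def)
    then show ?thesis using cd by simp
  qed
qed

context group
begin

text \<open>The canonical image of \<open>point g\<close> in the bidual.\<close>

definition dirac :: "'a \<Rightarrow> (('a \<Rightarrow> complex) \<Rightarrow> complex) \<Rightarrow> complex" where
  "dirac g = bidual_of (\<lambda>f. f g)"

text \<open>This stands for membership in the bidual of \<open>\<ell>\<^sup>1(N)\<close>, viewed
  inside the bidual of \<open>\<ell>\<^sup>1(G)\<close>, so no second algebra has to be
  introduced.\<close>

definition concentrated :: "'a set \<Rightarrow> ((('a \<Rightarrow> complex) \<Rightarrow> complex) \<Rightarrow> complex) \<Rightarrow> bool" where
  "concentrated N \<Phi> \<longleftrightarrow> (\<forall>f g. bounded_fun f \<longrightarrow> bounded_fun g \<longrightarrow> (\<forall>x\<in>N. f x = g x) \<longrightarrow> pairing \<Phi> f = pairing \<Phi> g)"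

text \<open>
  An element of \<open>null_ideal M N\<close> is invariant under \<open>M\<close> and its image in the bidual of
  \<open>\<ell>\<^sup>1(G/M)\<close> is zero. Left invariance of \<open>\<Phi>\<close> makes \<open>\<Psi> \<box> \<Phi>\<close> depend only on that image of
  \<open>\<Psi>\<close>, so products of two elements vanish.
\<close>

definition null_ideal :: "'a set \<Rightarrow> 'a set \<Rightarrow> ((('a \<Rightarrow> complex) \<Rightarrow> complex) \<Rightarrow> complex) set" where
  "null_ideal M N = {\<Phi> \<in> carrier (bidual (l1 G)). concentrated N \<Phi> \<and>
     (\<forall>m\<in>M. \<forall>f. bounded_fun f \<longrightarrow> pairing \<Phi> (\<lambda>x. f (m \<otimes> x)) = pairing \<Phi> f) \<and>
     (\<forall>f. bounded_fun f \<longrightarrow> (\<forall>x\<in>carrier G. \<forall>m\<in>M. f (x \<otimes> m) = f x) \<longrightarrow> pairing \<Phi> f = 0)}"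

lemma concentratedD:
  "concentrated N \<Phi> \<Longrightarrow> bounded_fun f \<Longrightarrow> bounded_fun g \<Longrightarrow> (\<And>x. x \<in> N \<Longrightarrow> f x = g x) \<Longrightarrow>
     pairing \<Phi> f = pairing \<Phi> g"
  unfolding concentrated_def by blast

lemma null_idealD:
  assumes "\<Phi> \<in> null_ideal M N"
  shows "\<Phi> \<in> carrier (bidual (l1 G))" "concentrated N \<Phi>"
    and "\<And>m f. m \<in> M \<Longrightarrow> bounded_fun f \<Longrightarrow> pairing \<Phi> (\<lambda>x. f (m \<otimes> x)) = pairing \<Phi> f"
    and "\<And>f. bounded_fun f \<Longrightarrow> (\<And>x m. x \<in> carrier G \<Longrightarrow> m \<in> M \<Longrightarrow> f (x \<otimes> m) = f x) \<Longrightarrow> pairing \<Phi> f = 0"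
  using assms by (simp_all add: null_ideal_def del: bidual_sel)

section \<open>Point masses and conjugation in the bidual\<close>

lemma dirac_closed: "g \<in> carrier G \<Longrightarrow> dirac g \<in> carrier (bidual (l1 G))"
  unfolding dirac_def by (rule bidual_of_closed [OF bounded_form_eval])

lemma pairing_dirac: "g \<in> carrier G \<Longrightarrow> bounded_fun f \<Longrightarrow> pairing (dirac g) f = f g"
  unfolding dirac_def by (rule pairing_bidual_of [OF bounded_form_eval])

lemma bounded_fun_translate_right:
  "bounded_fun f \<Longrightarrow> x \<in> carrier G \<Longrightarrow> bounded_fun (\<lambda>y. f (y \<otimes> x))"
  by (rule bounded_fun_comp) auto

lemma dirac_mult:
  assumes "g \<in> carrier G" "h \<in> carrier G"
  shows "dirac g \<otimes>\<^bsub>bidual (l1 G)\<^esub> dirac h = dirac (g \<otimes> h)"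
  by (rule bidual_eqI)
    (use assms in \<open>simp_all add: pairing_mult dirac_closed pairing_dirac bounded_fun_translate
       bounded_fun_translate_right bidual_mult_closed bounded_fun_pairing del: bidual_sel\<close>)

lemma dirac_one: "dirac \<one> = \<one>\<^bsub>bidual (l1 G)\<^esub>"
  by (simp add: dirac_def bidual_one)

lemma dirac_Units: "g \<in> carrier G \<Longrightarrow> dirac g \<in> Units (bidual (l1 G))"
  unfolding Units_def using dirac_mult [of g "inv g"] dirac_mult [of "inv g" g] dirac_closed [of g]
    dirac_closed [of "inv g"] by (auto simp: dirac_one simp del: bidual_sel)

lemma inv_dirac: "g \<in> carrier G \<Longrightarrow> inv\<^bsub>bidual (l1 G)\<^esub> (dirac g) = dirac (inv g)"
proof -
  assume g: "g \<in> carrier G"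
  interpret B: ring "bidual (l1 G)" by (rule ring_bidual)
  show ?thesis
    by (rule B.inv_unique' [symmetric]) (use g in \<open>simp_all add: dirac_mult dirac_one dirac_closed del: bidual_sel\<close>)
qed

lemma bounded_fun_sum: "finite T \<Longrightarrow> (\<And>t. t \<in> T \<Longrightarrow> bounded_fun (f t)) \<Longrightarrow> bounded_fun (\<lambda>x. \<Sum>t\<in>T. f t x)"
  by (induction T rule: finite_induct) (simp_all add: bounded_fun_add)

lemma bounded_form_sum:
  assumes "bounded_form p" "finite T" "\<And>t. t \<in> T \<Longrightarrow> bounded_fun (f t)"
  shows "p (\<lambda>x. \<Sum>t\<in>T. f t x) = (\<Sum>t\<in>T. p (f t))"
  using assms(2,3)
  by (induction T rule: finite_induct)
    (simp_all add: bounded_form_zero [OF assms(1)] bounded_formD(1) [OF assms(1)] bounded_fun_sum)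

lemma pairing_finsum:
  assumes "finite T" "\<And>t. t \<in> T \<Longrightarrow> c t \<in> carrier (bidual (l1 G))"
  shows "pairing (\<Oplus>\<^bsub>bidual (l1 G)\<^esub>t\<in>T. c t) f = (\<Sum>t\<in>T. pairing (c t) f)"
proof -
  interpret B: ring "bidual (l1 G)" by (rule ring_bidual)
  show ?thesis
    using assms
    by (induction T rule: finite_induct)
      (simp_all add: pairing_add pairing_zero B.finsum_insert Pi_def del: bidual_sel)
qed

text \<open>Conjugating by a point mass replaces the argument \<open>x\<close> of the test function
  by \<open>g \<otimes> x \<otimes> inv g\<close>, and this substitution maps the normal subgroup
  \<open>N\<close> into itself.\<close>

lemma concentrated_conj:
  assumes N: "N \<lhd> G" and g: "g \<in> carrier G"
    and b: "b \<in> carrier (bidual (l1 G))" "concentrated N b"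
  shows "concentrated N (dirac g \<otimes>\<^bsub>bidual (l1 G)\<^esub> b \<otimes>\<^bsub>bidual (l1 G)\<^esub> dirac (inv g))"
  unfolding concentrated_def
proof (intro allI impI)
  fix f h assume f: "bounded_fun f" and h: "bounded_fun h" and eq: "\<forall>x\<in>N. f x = h x"
  have *: "pairing (dirac g \<otimes>\<^bsub>bidual (l1 G)\<^esub> b \<otimes>\<^bsub>bidual (l1 G)\<^esub> dirac (inv g)) k
      = pairing b (\<lambda>x. k (g \<otimes> x \<otimes> inv g))" if "bounded_fun k" for k
  proof -
    note [simp] = g b(1) that dirac_closed bidual_mult_closed
    note [simp del] = bidual_sel
    let ?k = "\<lambda>x. k (x \<otimes> inv g)"
    have k: "bounded_fun ?k" by (rule bounded_fun_translate_right) simp_all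
    have "pairing (dirac g \<otimes>\<^bsub>bidual (l1 G)\<^esub> b \<otimes>\<^bsub>bidual (l1 G)\<^esub> dirac (inv g)) k
        = pairing (dirac g \<otimes>\<^bsub>bidual (l1 G)\<^esub> b) ?k"
      by (simp add: pairing_mult pairing_dirac bounded_fun_translate cong: pairing_cong)
    also have "\<dots> = pairing (dirac g) (\<lambda>x. pairing b (\<lambda>y. ?k (x \<otimes> y)))"
      by (rule pairing_mult) (simp_all add: k)
    also have "\<dots> = pairing b (\<lambda>y. ?k (g \<otimes> y))"
      by (rule pairing_dirac [OF g bounded_fun_pairing [OF b(1) k]])
    finally show ?thesis .
  qed
  have "pairing b (\<lambda>x. f (g \<otimes> x \<otimes> inv g)) = pairing b (\<lambda>x. h (g \<otimes> x \<otimes> inv g))"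
    by (rule concentratedD [OF b(2)])
      (use f h eq g normal.inv_op_closed2 [OF N g] in \<open>auto intro: bounded_fun_comp\<close>)
  then show "pairing (dirac g \<otimes>\<^bsub>bidual (l1 G)\<^esub> b \<otimes>\<^bsub>bidual (l1 G)\<^esub> dirac (inv g)) f =
      pairing (dirac g \<otimes>\<^bsub>bidual (l1 G)\<^esub> b \<otimes>\<^bsub>bidual (l1 G)\<^esub> dirac (inv g)) h"
    using * f h by simp
qed

text \<open>Left invariance passes to the product from the left factor. For the vanishing condition,
  \<open>x \<otimes> m \<otimes> y = x \<otimes> y \<otimes> (inv y \<otimes> m \<otimes> y)\<close>
  shows that integrating out \<open>y\<close> keeps right \<open>M\<close>-invariance of the test
  function. This needs \<open>y\<close> to range over \<open>N\<close> only, whence the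
  concentration of \<open>b\<close>.\<close>

lemma null_ideal_mult_right:
  assumes N: "subgroup N G" and MN: "M \<subseteq> N"
    and conj: "\<And>y m. y \<in> N \<Longrightarrow> m \<in> M \<Longrightarrow> inv y \<otimes> m \<otimes> y \<in> M"
    and j: "j \<in> null_ideal M N" and b: "b \<in> carrier (bidual (l1 G))" "concentrated N b"
  shows "j \<otimes>\<^bsub>bidual (l1 G)\<^esub> b \<in> null_ideal M N"
proof -
  note jD = null_idealD [OF j]
  have Nc [simp]: "x \<in> N \<Longrightarrow> x \<in> carrier G" for x using subgroup.mem_carrier [OF N] .
  have Mc [simp]: "x \<in> M \<Longrightarrow> x \<in> carrier G" for x using MN by auto
  note [simp] = jD(1) b(1) bounded_fun_translate bounded_fun_pairing bidual_mult_closed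
  note [simp del] = bidual_sel
  let ?jb = "j \<otimes>\<^bsub>bidual (l1 G)\<^esub> b"
  have "concentrated N ?jb"
    unfolding concentrated_def
    by (auto simp: pairing_mult subgroup.m_closed [OF N]
        intro!: concentratedD [OF jD(2)] concentratedD [OF b(2)])
  moreover have "pairing ?jb (\<lambda>x. f (m \<otimes> x)) = pairing ?jb f" if "m \<in> M" "bounded_fun f" for m f
  proof -
    have "pairing ?jb (\<lambda>x. f (m \<otimes> x)) = pairing j (\<lambda>x. pairing b (\<lambda>y. f (m \<otimes> x \<otimes> y)))"
      using that by (simp add: pairing_mult m_assoc cong: pairing_cong)
    also have "\<dots> = pairing ?jb f"
      using that jD(3) [OF that(1), of "\<lambda>x. pairing b (\<lambda>y. f (x \<otimes> y))"]
      by (simp add: pairing_mult)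
    finally show ?thesis .
  qed
  moreover have "pairing ?jb f = 0"
    if f: "bounded_fun f" and inv: "\<forall>x\<in>carrier G. \<forall>m\<in>M. f (x \<otimes> m) = f x" for f
  proof -
    have "pairing b (\<lambda>y. f (x \<otimes> m \<otimes> y)) = pairing b (\<lambda>y. f (x \<otimes> y))"
      if x: "x \<in> carrier G" and m: "m \<in> M" for x m
    proof (rule concentratedD [OF b(2)])
      fix y assume y: "y \<in> N"
      have "y \<otimes> (inv y \<otimes> (m \<otimes> y)) = m \<otimes> y"
        using m y by (subst m_assoc [symmetric]) simp_all
      then have "x \<otimes> m \<otimes> y = x \<otimes> y \<otimes> (inv y \<otimes> m \<otimes> y)"
        using x m y by (simp add: m_assoc)
      then show "f (x \<otimes> m \<otimes> y) = f (x \<otimes> y)"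
        using inv x y conj [OF y m] by simp
    qed (use f x m in auto)
    then show ?thesis
      using f jD(4) [of "\<lambda>x. pairing b (\<lambda>y. f (x \<otimes> y))"] by (simp add: pairing_mult)
  qed
  ultimately show ?thesis by (simp add: null_ideal_def)
qed

lemma null_ideal_square:
  assumes "M \<subseteq> carrier G" and i: "i \<in> null_ideal M N" and j: "j \<in> null_ideal M N"
  shows "j \<otimes>\<^bsub>bidual (l1 G)\<^esub> i = \<zero>\<^bsub>bidual (l1 G)\<^esub>"
proof (rule bidual_eqI)
  note iD = null_idealD [OF i] and jD = null_idealD [OF j]
  fix f assume f: "bounded_fun f"
  have "pairing j (\<lambda>x. pairing i (\<lambda>y. f (x \<otimes> y))) = 0"
  proof (rule jD(4))
    fix x m assume x: "x \<in> carrier G" and m: "m \<in> M"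
    have "pairing i (\<lambda>y. f (x \<otimes> m \<otimes> y)) = pairing i (\<lambda>y. f (x \<otimes> (m \<otimes> y)))"
      using x m assms(1) by (intro pairing_cong) (auto simp: m_assoc)
    then show "pairing i (\<lambda>y. f (x \<otimes> m \<otimes> y)) = pairing i (\<lambda>y. f (x \<otimes> y))"
      using iD(3) [OF m bounded_fun_translate [OF f x]] by simp
  qed (rule bounded_fun_pairing [OF iD(1) f])
  then show "pairing (j \<otimes>\<^bsub>bidual (l1 G)\<^esub> i) f = pairing \<zero>\<^bsub>bidual (l1 G)\<^esub> f"
    by (simp add: pairing_mult iD(1) jD(1) f pairing_zero del: bidual_sel)
qed (use null_idealD(1) [OF i] null_idealD(1) [OF j] in \<open>simp_all add: bidual_closed del: bidual_sel\<close>)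

text \<open>Cut \<open>b\<close> into its parts on the finitely many cosets \<open>N #> t\<close>,
  and move each part into \<open>N\<close> by right translation with \<open>inv t\<close>;
  multiplying by \<open>dirac t\<close> moves it back.\<close>

lemma coset_decomposition:
  assumes N: "subgroup N G" and fin: "finite T" and T: "T \<subseteq> carrier G"
    and cover: "\<And>x. x \<in> carrier G \<Longrightarrow> \<exists>t\<in>T. x \<in> N #> t"
    and disj: "\<And>x s t. \<lbrakk>s \<in> T; t \<in> T; x \<in> N #> s; x \<in> N #> t\<rbrakk> \<Longrightarrow> s = t"
    and b: "b \<in> carrier (bidual (l1 G))"
  obtains c where "c \<in> T \<rightarrow> carrier (bidual (l1 G))" "\<forall>t\<in>T. concentrated N (c t)"
    "b = (\<Oplus>\<^bsub>bidual (l1 G)\<^esub>t\<in>T. c t \<otimes>\<^bsub>bidual (l1 G)\<^esub> dirac t)"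
proof
  interpret B: ring "bidual (l1 G)" by (rule ring_bidual)
  note [simp del] = bidual_sel
  \<comment> \<open>The indicator restricts to the coset of \<open>t\<close>, where
    \<open>x \<otimes> inv t\<close> lies in \<open>N\<close>.\<close>
  let ?T = "\<lambda>t f x. of_bool (x \<in> N #> t) * f (x \<otimes> inv t)"
  define c where "c t = bidual_of (\<lambda>f. pairing b (?T t f))" for t
  have form: "bounded_form (\<lambda>f. pairing b (?T t f))" if "t \<in> T" for t
  proof (rule bounded_form_comp [OF bounded_form_pairing [OF b], where L = 1])
    fix f :: "'a \<Rightarrow> complex" and C x
    assume f: "\<forall>x\<in>carrier G. cmod (f x) \<le> C" and x: "x \<in> carrier G"
    show "cmod (?T t f x) \<le> 1 * C"
      using f x that T by (auto simp: norm_mult intro: order_trans [OF norm_ge_zero, of "f x"])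
  qed (simp_all add: distrib_left)
  have c: "t \<in> T \<Longrightarrow> c t \<in> carrier (bidual (l1 G))" for t
    unfolding c_def by (rule bidual_of_closed [OF form])
  then show "c \<in> T \<rightarrow> carrier (bidual (l1 G))" by blast
  have pc: "pairing (c t) f = pairing b (?T t f)" if "t \<in> T" "bounded_fun f" for t f
    unfolding c_def by (rule pairing_bidual_of [OF form [OF that(1)] that(2)])
  show "\<forall>t\<in>T. concentrated N (c t)"
    unfolding concentrated_def
  proof (intro ballI allI impI)
    fix t f g assume t: "t \<in> T" and f: "bounded_fun f" and g: "bounded_fun g" and eq: "\<forall>x\<in>N. f x = g x"
    have "x \<otimes> inv t \<in> N" if "x \<in> N #> t" for x
      using that t T subgroup.mem_carrier [OF N] unfolding r_coset_def
      by (auto simp: m_assoc subset_eq)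
    then have "pairing b (?T t f) = pairing b (?T t g)"
      using eq by (intro pairing_cong) auto
    then show "pairing (c t) f = pairing (c t) g" using pc t f g by simp
  qed
  show "b = (\<Oplus>\<^bsub>bidual (l1 G)\<^esub>t\<in>T. c t \<otimes>\<^bsub>bidual (l1 G)\<^esub> dirac t)"
  proof (rule bidual_eqI [OF b])
    show "(\<Oplus>\<^bsub>bidual (l1 G)\<^esub>t\<in>T. c t \<otimes>\<^bsub>bidual (l1 G)\<^esub> dirac t) \<in> carrier (bidual (l1 G))"
      using c T by (auto intro!: B.finsum_closed bidual_mult_closed dirac_closed)
    fix f assume f: "bounded_fun f"
    have "pairing b f = pairing b (\<lambda>x. \<Sum>t\<in>T. of_bool (x \<in> N #> t) * f x)"
    proof (rule pairing_cong)
      fix x assume "x \<in> carrier G"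
      then obtain s where s: "s \<in> T" "x \<in> N #> s" using cover by blast
      have "(\<Sum>t\<in>T. of_bool (x \<in> N #> t) * f x) = (\<Sum>t\<in>T. if t = s then f x else 0)"
        using s disj by (intro sum.cong) auto
      then show "f x = (\<Sum>t\<in>T. of_bool (x \<in> N #> t) * f x)"
        using s fin by (simp add: sum.delta)
    qed
    also have "\<dots> = (\<Sum>t\<in>T. pairing b (\<lambda>x. of_bool (x \<in> N #> t) * f x))"
      by (rule bounded_form_sum [OF bounded_form_pairing [OF b] fin]) (simp add: bounded_fun_mult f)
    also have "\<dots> = (\<Sum>t\<in>T. pairing (c t \<otimes>\<^bsub>bidual (l1 G)\<^esub> dirac t) f)"
    proof (rule sum.cong [OF refl])
      fix t assume t: "t \<in> T"
      then have tc: "t \<in> carrier G" using T by blast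
      have "pairing (c t \<otimes>\<^bsub>bidual (l1 G)\<^esub> dirac t) f = pairing (c t) (\<lambda>x. f (x \<otimes> t))"
        using t tc c f
        by (simp add: pairing_mult dirac_closed pairing_dirac bounded_fun_translate cong: pairing_cong)
      also have "\<dots> = pairing b (\<lambda>x. of_bool (x \<in> N #> t) * f x)"
        unfolding pc [OF t bounded_fun_translate_right [OF f tc]]
        by (rule pairing_cong) (simp add: m_assoc tc)
      finally show "pairing b (\<lambda>x. of_bool (x \<in> N #> t) * f x) = pairing (c t \<otimes>\<^bsub>bidual (l1 G)\<^esub> dirac t) f" ..
    qed
    also have "\<dots> = pairing (\<Oplus>\<^bsub>bidual (l1 G)\<^esub>t\<in>T. c t \<otimes>\<^bsub>bidual (l1 G)\<^esub> dirac t) f"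
      using c T by (subst pairing_finsum [OF fin]) (auto intro!: bidual_mult_closed dirac_closed)
    finally show "pairing b f = pairing (\<Oplus>\<^bsub>bidual (l1 G)\<^esub>t\<in>T. c t \<otimes>\<^bsub>bidual (l1 G)\<^esub> dirac t) f" .
  qed
qed

text \<open>The criterion \<open>subset_jacobson_radicalI\<close> is applied to the point masses of
  a transversal of \<open>N\<close>. A \<open>G\<close>-conjugate of an element of the ideal may
  leave it, because \<open>M\<close> is assumed stable only under conjugation by \<open>N\<close>.
  The conjugate is still concentrated on \<open>N\<close>, though, and right multiplication by such
  elements preserves the ideal.\<close>

theorem null_ideal_subset_radical:
  assumes N: "N \<lhd> G" and fin: "finite (rcosets N)" and MN: "M \<subseteq> N"
    and conj: "\<And>y m. y \<in> N \<Longrightarrow> m \<in> M \<Longrightarrow> inv y \<otimes> m \<otimes> y \<in> M"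
  shows "null_ideal M N \<subseteq> jacobson_radical (bidual (l1 G))"
proof -
  interpret B: ring "bidual (l1 G)" by (rule ring_bidual)
  note [simp del] = bidual_sel
  have Ns: "subgroup N G" using N by (rule normal_imp_subgroup)
  note mult = null_ideal_mult_right [OF Ns MN]
  obtain T where T: "finite T" "T \<subseteq> carrier G"
    "\<And>x. x \<in> carrier G \<Longrightarrow> \<exists>t\<in>T. x \<in> N #> t"
    "\<And>x s t. \<lbrakk>s \<in> T; t \<in> T; x \<in> N #> s; x \<in> N #> t\<rbrakk> \<Longrightarrow> s = t"
    using rcosets_transversal [OF Ns fin] by blast
  show ?thesis
  proof (rule B.subset_jacobson_radicalI [OF T(1), where u = dirac])
    show "dirac \<in> T \<rightarrow> Units (bidual (l1 G))" using T(2) dirac_Units by blast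
    show "null_ideal M N \<subseteq> carrier (bidual (l1 G))" using null_idealD(1) by blast
    show "j \<otimes>\<^bsub>bidual (l1 G)\<^esub> i = \<zero>\<^bsub>bidual (l1 G)\<^esub>" if "i \<in> null_ideal M N" "j \<in> null_ideal M N" for i j
      by (rule null_ideal_square [OF _ that]) (use MN subgroup.subset [OF Ns] in blast)
  next
    fix s t i j assume st: "s \<in> T" "t \<in> T" and i: "i \<in> null_ideal M N" and j: "j \<in> null_ideal M N"
    let ?g = "s \<otimes> inv t"
    have stc: "s \<in> carrier G" "t \<in> carrier G" using st T(2) by auto
    \<comment> \<open>The two nested conjugations collapse to conjugation by the single group
      element \<open>s \<otimes> inv t\<close>.\<close>
    have "dirac s \<otimes>\<^bsub>bidual (l1 G)\<^esub> inv\<^bsub>bidual (l1 G)\<^esub> dirac t \<otimes>\<^bsub>bidual (l1 G)\<^esub> i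
        \<otimes>\<^bsub>bidual (l1 G)\<^esub> dirac t \<otimes>\<^bsub>bidual (l1 G)\<^esub> inv\<^bsub>bidual (l1 G)\<^esub> dirac s
      = dirac ?g \<otimes>\<^bsub>bidual (l1 G)\<^esub> i \<otimes>\<^bsub>bidual (l1 G)\<^esub> dirac (inv ?g)"
      using stc null_idealD(1) [OF i]
      by (simp add: inv_dirac dirac_mult dirac_closed B.m_assoc inv_mult_group)
    moreover have "concentrated N \<dots>"
      using stc by (intro concentrated_conj [OF N] null_idealD [OF i]) auto
    ultimately show "j \<otimes>\<^bsub>bidual (l1 G)\<^esub> (dirac s \<otimes>\<^bsub>bidual (l1 G)\<^esub> inv\<^bsub>bidual (l1 G)\<^esub> dirac t \<otimes>\<^bsub>bidual (l1 G)\<^esub> i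
        \<otimes>\<^bsub>bidual (l1 G)\<^esub> dirac t \<otimes>\<^bsub>bidual (l1 G)\<^esub> inv\<^bsub>bidual (l1 G)\<^esub> dirac s) \<in> null_ideal M N"
      using stc null_idealD(1) [OF i] by (intro mult [OF _ j] conj) (auto simp: dirac_closed)
  next
    fix b assume b: "b \<in> carrier (bidual (l1 G))"
    obtain c where c: "c \<in> T \<rightarrow> carrier (bidual (l1 G))" "\<forall>t\<in>T. concentrated N (c t)"
      "b = (\<Oplus>\<^bsub>bidual (l1 G)\<^esub>t\<in>T. c t \<otimes>\<^bsub>bidual (l1 G)\<^esub> dirac t)"
      by (rule coset_decomposition [OF Ns T(1,2) _ _ b]) (assumption | rule T(3) that | erule (3) T(4))+
    have "i \<otimes>\<^bsub>bidual (l1 G)\<^esub> c t \<in> null_ideal M N" if "t \<in> T" "i \<in> null_ideal M N" for t i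
      using c(1) that(1) by (intro mult [OF _ that(2)] bspec [OF c(2)] conj) auto
    then have "\<forall>t\<in>T. \<forall>i\<in>null_ideal M N. i \<otimes>\<^bsub>bidual (l1 G)\<^esub> c t \<in> null_ideal M N"
      by simp
    with c(3) show "\<exists>c\<in>T \<rightarrow> carrier (bidual (l1 G)). b = (\<Oplus>\<^bsub>bidual (l1 G)\<^esub>t\<in>T. c t \<otimes>\<^bsub>bidual (l1 G)\<^esub> dirac t) \<and>
        (\<forall>t\<in>T. \<forall>i\<in>null_ideal M N. i \<otimes>\<^bsub>bidual (l1 G)\<^esub> c t \<in> null_ideal M N)"
      by (intro bexI [OF conjI c(1)])
  qed
qed

end

section \<open>Equivariant maps and bithick sets\<close>

text \<open>Choose a representative \<open>t\<close> in each coset of \<open>H\<close>, write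
  \<open>x = h \<otimes> t\<close>, and let \<open>\<nu> x\<close> be \<open>h\<close>. Such maps
  transport means and sets between \<open>G\<close> and \<open>H\<close>.\<close>

lemma (in group) ex_left_equivariant:
  assumes H: "subgroup H G"
  shows "\<exists>\<nu>. (\<forall>x\<in>carrier G. \<nu> x \<in> H) \<and> (\<forall>h\<in>H. \<forall>x\<in>carrier G. \<nu> (h \<otimes> x) = h \<otimes> \<nu> x)"
proof -
  note Hc [simp] = subgroup.mem_carrier [OF H]
  define rep where "rep c = (SOME x. x \<in> c)" for c :: "'a set"
  have rep: "rep (H #> x) \<in> H #> x" if "x \<in> carrier G" for x
    unfolding rep_def using rcos_self [OF that H] by (rule someI)
  have "x \<otimes> inv (rep (H #> x)) \<in> H" if x: "x \<in> carrier G" for x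
  proof -
    obtain h where h: "h \<in> H" "rep (H #> x) = h \<otimes> x"
      using rep [OF x] by (auto simp: r_coset_def)
    have "x \<otimes> inv (h \<otimes> x) = inv h"
      using h(1) x by (simp add: inv_mult_group m_assoc [symmetric])
    then show ?thesis using h subgroup.m_inv_closed [OF H] by simp
  qed
  moreover have "h \<otimes> x \<otimes> inv (rep (H #> (h \<otimes> x))) = h \<otimes> (x \<otimes> inv (rep (H #> x)))"
    if h: "h \<in> H" and x: "x \<in> carrier G" for h x
  proof -
    have "H #> (h \<otimes> x) = H #> x"
      using coset_mult_assoc [OF subgroup.subset [OF H], of h x] coset_join2 [OF _ H h] h x by simp
    moreover have "rep (H #> x) \<in> carrier G"
      using rep [OF x] r_coset_subset_G [OF subgroup.subset [OF H] x] by blast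
    ultimately show ?thesis using h x by (simp add: m_assoc)
  qed
  ultimately show ?thesis by (intro exI [of _ "\<lambda>x. x \<otimes> inv (rep (H #> x))"]) blast
qed

text \<open>Inversion exchanges left and right multiplication, so a left equivariant map is
  conjugated by it.\<close>

lemma (in group) ex_right_equivariant:
  assumes H: "subgroup H G"
  shows "\<exists>\<kappa>. (\<forall>x\<in>carrier G. \<kappa> x \<in> H) \<and> (\<forall>x\<in>carrier G. \<forall>h\<in>H. \<kappa> (x \<otimes> h) = \<kappa> x \<otimes> h)"
proof -
  note [simp] = subgroup.mem_carrier [OF H] subgroup.m_inv_closed [OF H]
  obtain \<nu> where \<nu> [simp]: "\<And>x. x \<in> carrier G \<Longrightarrow> \<nu> x \<in> H"
    and \<nu>eq: "\<And>h x. h \<in> H \<Longrightarrow> x \<in> carrier G \<Longrightarrow> \<nu> (h \<otimes> x) = h \<otimes> \<nu> x"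
    using ex_left_equivariant [OF H] by blast
  have "inv (\<nu> (inv (x \<otimes> h))) = inv (\<nu> (inv x)) \<otimes> h" if "x \<in> carrier G" "h \<in> H" for x h
    using that by (simp add: inv_mult_group \<nu>eq)
  then show ?thesis by (intro exI [of _ "\<lambda>x. inv (\<nu> (inv x))"]) simp
qed

section \<open>Countable subgroups and bithick sets\<close>

lemma (in group) countable_generate:
  assumes S: "S \<subseteq> carrier G" and "countable S"
  shows "countable (generate G S)"
proof -
  \<comment> \<open>Elements of the generated subgroup are products of finite words in
    \<open>S\<close> and its inverses, and there are only countably many words.\<close>
  let ?A = "S \<union> m_inv G ` S"
  let ?f = "\<lambda>xs. foldr (\<otimes>) xs \<one>"
  have c: "?f xs \<in> carrier G" if "xs \<in> lists ?A" for xs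
    using that S by (induction xs) auto
  have app: "?f (xs @ ys) = ?f xs \<otimes> ?f ys" if "xs \<in> lists ?A" "ys \<in> lists ?A" for xs ys
    using that
  proof (induction xs)
    case (Cons x xs)
    then show ?case using c [of xs] c [of ys] S by (auto simp: m_assoc)
  qed (simp add: c)
  have "x \<in> ?f ` lists ?A" if "x \<in> generate G S" for x
    using that
  proof (induction rule: generate.induct)
    case one
    show ?case by (rule image_eqI [of _ _ "[]"]) auto
  next
    case (incl h)
    then show ?case using S by (intro image_eqI [of _ _ "[h]"]) auto
  next
    case (inv h)
    then show ?case using S by (intro image_eqI [of _ _ "[inv h]"]) auto
  next
    case (eng g h)
    then obtain xs ys where "g = ?f xs" "xs \<in> lists ?A" "h = ?f ys" "ys \<in> lists ?A" by blast
    then show ?case using app [of xs ys] by (intro image_eqI [of _ _ "xs @ ys"]) auto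
  qed
  moreover have "countable (?f ` lists ?A)" using assms by (intro countable_image countable_lists) auto
  ultimately show ?thesis by (meson countable_subset subsetI)
qed

lemma (in group) ex_countable_infinite_subgroup:
  assumes "infinite (carrier G)"
  shows "\<exists>C. subgroup C G \<and> countable C \<and> infinite C"
proof -
  obtain S where S: "S \<subseteq> carrier G" "infinite S" "countable S"
    using infinite_countable_subset' [OF assms] by blast
  have "S \<subseteq> generate G S" by (auto intro: generate.incl)
  then have "infinite (generate G S)" using S(2) by (rule infinite_super)
  then show ?thesis
    using countable_generate [OF S(1,3)] generate_is_subgroup [OF S(1)] by blast
qed

text \<open>The points \<open>w n\<close> are chosen recursively: disjointness from the earlier
  translates excludes only finitely many candidates, and the group is infinite.\<close>

lemma (in group) ex_disjoint_translates:
  fixes c :: "nat \<Rightarrow> 'a"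
  assumes inf: "infinite (carrier G)" and c: "\<And>i. c i \<in> carrier G"
  shows "\<exists>w. (\<forall>n. w n \<in> carrier G) \<and> (\<forall>m n i j. m \<noteq> n \<longrightarrow> i \<le> m \<longrightarrow> j \<le> n \<longrightarrow> c i \<otimes> w m \<noteq> c j \<otimes> w n)"
proof -
  \<comment> \<open>Only earlier indices \<open>k < n\<close> are constrained; the symmetric
    statement for \<open>m \<noteq> n\<close> follows by comparing \<open>m\<close> and
    \<open>n\<close>.\<close>
  let ?P = "\<lambda>w (n :: nat) x. x \<in> carrier G \<and> (\<forall>k<n. \<forall>i\<le>n. \<forall>j\<le>k. c i \<otimes> x \<noteq> c j \<otimes> w k)"
  have "\<exists>w. \<forall>n. ?P w n (w n)"
  proof (rule dependent_wellorder_choice)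
    fix n :: nat and w :: "nat \<Rightarrow> 'a"
    assume w: "\<And>k. k < n \<Longrightarrow> ?P w k (w k)"
    let ?B = "(\<lambda>(k, i, j). inv (c i) \<otimes> (c j \<otimes> w k)) ` ({..<n} \<times> {..n} \<times> {..n})"
    have "finite ?B" by simp
    then obtain x where x: "x \<in> carrier G" "x \<notin> ?B"
      using inf finite_subset [of "carrier G" ?B] by blast
    have "c i \<otimes> x \<noteq> c j \<otimes> w k" if k: "k < n" "i \<le> n" "j \<le> k" for i j k
    proof
      assume "c i \<otimes> x = c j \<otimes> w k"
      then have "inv (c i) \<otimes> (c j \<otimes> w k) = inv (c i) \<otimes> (c i \<otimes> x)" by simp
      also have "\<dots> = x" using c x(1) by (simp add: m_assoc [symmetric])
      finally have "x = inv (c i) \<otimes> (c j \<otimes> w k)" ..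
      then have "x \<in> ?B" using k by (intro image_eqI [of _ _ "(k, i, j)"]) auto
      with x(2) show False by blast
    qed
    then show "\<exists>x. ?P w n x" using x(1) by blast
  qed simp
  then obtain w where w: "\<And>n. ?P w n (w n)" by blast
  have "c i \<otimes> w m \<noteq> c j \<otimes> w n" if "m \<noteq> n" "i \<le> m" "j \<le> n" for m n i j
    using w [of m] w [of n] that by (cases "m < n") (metis linorder_neqE_nat)+
  then show ?thesis using w by blast
qed

text \<open>
  The set \<open>A\<close> and its complement both contain a translate \<open>F \<otimes> x\<close> of every finite set \<open>F\<close>. For a
  countable group enumerated by \<open>c\<close>, take \<open>A\<close> to be the union over even \<open>n\<close> of the translates
  \<open>{c 0, \<dots>, c n} \<otimes> w n\<close>, pairwise disjoint for suitable \<open>w\<close>, and use odd \<open>n\<close> for the complement.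
  In general, pull this back from a countable subgroup along an equivariant map.
\<close>

lemma (in group) ex_bithick_set:
  assumes inf: "infinite (carrier G)"
  shows "\<exists>A y z. (\<forall>n :: nat. y n \<in> carrier G \<and> z n \<in> carrier G) \<and>
    (\<forall>x\<in>carrier G. (\<forall>\<^sub>F n in sequentially. x \<otimes> y n \<in> A) \<and> (\<forall>\<^sub>F n in sequentially. x \<otimes> z n \<notin> A))"
proof -
  obtain C where C: "subgroup C G" "countable C" "infinite C"
    using ex_countable_infinite_subgroup [OF inf] by blast
  note Cc [simp] = subgroup.mem_carrier [OF C(1)]
  define c where "c = from_nat_into C"
  have c: "c i \<in> C" for i
    unfolding c_def using C(3) by (intro from_nat_into) auto
  have cs: "\<exists>i. x = c i" if "x \<in> C" for x
    unfolding c_def using C(2) that by (metis from_nat_into_to_nat_on)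
  interpret GC: group "G\<lparr>carrier := C\<rparr>"
    by (rule subgroup.subgroup_is_group [OF C(1) group_axioms])
  have "\<exists>w. (\<forall>n. w n \<in> C) \<and> (\<forall>m n i j. m \<noteq> n \<longrightarrow> i \<le> m \<longrightarrow> j \<le> n \<longrightarrow> c i \<otimes> w m \<noteq> c j \<otimes> w n)"
    using GC.ex_disjoint_translates [of c] c C(3) by simp
  then obtain w where w: "\<And>n. w n \<in> C"
    and dis: "\<And>m n i j. m \<noteq> n \<Longrightarrow> i \<le> m \<Longrightarrow> j \<le> n \<Longrightarrow> c i \<otimes> w m \<noteq> c j \<otimes> w n"
    by blast
  obtain \<kappa> where \<kappa>: "\<And>x. x \<in> carrier G \<Longrightarrow> \<kappa> x \<in> C"
    and \<kappa>eq: "\<And>x h. x \<in> carrier G \<Longrightarrow> h \<in> C \<Longrightarrow> \<kappa> (x \<otimes> h) = \<kappa> x \<otimes> h"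
    using ex_right_equivariant [OF C(1)] by blast
  define A where "A = {x. \<exists>n i. i \<le> 2 * n \<and> \<kappa> x = c i \<otimes> w (2 * n)}"
  have "\<forall>\<^sub>F n in sequentially. x \<otimes> w (2 * n) \<in> A" if x: "x \<in> carrier G" for x
  proof -
    \<comment> \<open>Equivariance gives
      \<open>\<kappa> (x \<otimes> w (2 * n)) = c i \<otimes> w (2 * n)\<close>, which belongs to
      the block with index \<open>2 * n\<close> once \<open>i \<le> n\<close>.\<close>
    obtain i where i: "\<kappa> x = c i" using cs [OF \<kappa> [OF x]] by blast
    have "x \<otimes> w (2 * n) \<in> A" if "n \<ge> i" for n
      unfolding A_def using i \<kappa>eq [OF x w] that by (intro CollectI exI [of _ n] exI [of _ i]) simp
    then show ?thesis by (auto simp: eventually_sequentially)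
  qed
  moreover have "\<forall>\<^sub>F n in sequentially. x \<otimes> w (2 * n + 1) \<notin> A" if x: "x \<in> carrier G" for x
  proof -
    obtain i where i: "\<kappa> x = c i" using cs [OF \<kappa> [OF x]] by blast
    have "x \<otimes> w (2 * n + 1) \<notin> A" if n: "n \<ge> i" for n
    proof
      assume "x \<otimes> w (2 * n + 1) \<in> A"
      then obtain k j where "j \<le> 2 * k" "c i \<otimes> w (2 * n + 1) = c j \<otimes> w (2 * k)"
        unfolding A_def using i \<kappa>eq [OF x w] by auto
      \<comment> \<open>Blocks with odd and even indices are distinct, hence disjoint by the choice
        of \<open>w\<close>.\<close>
      moreover have "2 * n + 1 \<noteq> 2 * k" by presburger
      ultimately show False using dis [of "2 * n + 1" "2 * k" i j] n by simp
    qed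
    then show ?thesis by (auto simp: eventually_sequentially)
  qed
  ultimately show ?thesis
    using w by (intro exI [of _ A] exI [of _ "\<lambda>n. w (2 * n)"] exI [of _ "\<lambda>n. w (2 * n + 1)"]) auto
qed

text \<open>A bithick set of the infinite quotient \<open>G Mod H\<close> is pulled back, and the
  two sequences of cosets are lifted to \<open>G\<close>.\<close>

lemma (in normal) ex_invariant_bithick_set:
  assumes inf: "infinite (rcosets H)"
  shows "\<exists>A y z. (\<forall>x\<in>carrier G. \<forall>h\<in>H. x \<otimes> h \<in> A \<longleftrightarrow> x \<in> A) \<and>
    (\<forall>n :: nat. y n \<in> carrier G \<and> z n \<in> carrier G) \<and>
    (\<forall>x\<in>carrier G. (\<forall>\<^sub>F n in sequentially. x \<otimes> y n \<in> A) \<and> (\<forall>\<^sub>F n in sequentially. x \<otimes> z n \<notin> A))"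
proof -
  interpret Q: group "G Mod H" by (rule factorgroup_is_group)
  have cQ: "carrier (G Mod H) = rcosets H" by (simp add: FactGroup_def)
  obtain A Y Z where YZ: "\<And>n :: nat. Y n \<in> rcosets H" "\<And>n. Z n \<in> rcosets H"
    and A: "\<And>x. x \<in> rcosets H \<Longrightarrow> \<forall>\<^sub>F n in sequentially. x <#> Y n \<in> A"
      "\<And>x. x \<in> rcosets H \<Longrightarrow> \<forall>\<^sub>F n in sequentially. x <#> Z n \<notin> A"
    using Q.ex_bithick_set inf unfolding cQ mult_FactGroup by blast
  have "\<exists>y. \<forall>n :: nat. y n \<in> carrier G \<and> X n = H #> y n" if "\<And>n. X n \<in> rcosets H" for X
    using that unfolding RCOSETS_def by (intro choice) auto
  then obtain y z where y: "\<And>n. y n \<in> carrier G" "\<And>n. Y n = H #> y n"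
    and z: "\<And>n. z n \<in> carrier G" "\<And>n. Z n = H #> z n"
    using YZ by meson
  have "H #> (x \<otimes> h) = H #> x" if x: "x \<in> carrier G" and h: "h \<in> H" for x h
    using rcos_sum [OF x, of h] rcos_sum [OF x one_closed] h x
    by (simp add: rcos_const)
  moreover have "\<forall>\<^sub>F n in sequentially. H #> (x \<otimes> y n) \<in> A"
    "\<forall>\<^sub>F n in sequentially. H #> (x \<otimes> z n) \<notin> A" if x: "x \<in> carrier G" for x
    using A [OF rcosetsI [OF subset x]] by (simp_all add: y z rcos_sum x)
  ultimately show ?thesis
    using y(1) z(1) by (intro exI [of _ "{x. H #> x \<in> A}"] exI [of _ y] exI [of _ z]) simp
qed

context group
begin

subsection \<open>Functionals built from an invariant mean\<close>

definition invariant_mean :: "(('a \<Rightarrow> complex) \<Rightarrow> complex) \<Rightarrow> bool" where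
  "invariant_mean m \<longleftrightarrow> bounded_form m \<and> m (\<lambda>x. 1) = 1 \<and>
     (\<forall>g\<in>carrier G. \<forall>f. bounded_fun f \<longrightarrow> m (\<lambda>x. f (g \<otimes> x)) = m f)"

lemma amenable_invariant_mean:
  assumes "amenable G"
  shows "\<exists>m. invariant_mean m"
proof -
  obtain m where m: "bounded_functional (linf G) m" and one: "m \<one>\<^bsub>linf G\<^esub> = 1"
    and inv: "\<And>g f. g \<in> carrier G \<Longrightarrow> f \<in> carrier (linf G) \<Longrightarrow> m (left_translate G g f) = m f"
    using assms unfolding amenable_def by (auto simp: dual_def)
  \<comment> \<open>Elements of \<open>linf G\<close> vanish off the carrier, whereas test functions
    need not; \<open>?r\<close> passes from the latter to the former.\<close>
  let ?r = "\<lambda>f x. if x \<in> carrier G then f x else 0 :: complex"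
  have r: "?r f \<in> carrier (linf G)" if "bounded_fun f" for f
    using that by (auto simp: linf_def bounded_fun_def bounded_iff)
  obtain K where K: "\<And>f. f \<in> carrier (linf G) \<Longrightarrow> cmod (m f) \<le> K * nrm (linf G) f"
    using m unfolding bounded_functional_def by blast
  have bd: "cmod (m (?r f)) \<le> max K 0 * C" if C: "\<forall>x\<in>carrier G. cmod (f x) \<le> C" for f C
  proof -
    have f: "bounded_fun f" using C by (auto simp: bounded_fun_def)
    have "nrm (linf G) (?r f) \<le> C"
      unfolding linf_def using C one_closed by (auto intro!: cSUP_least)
    moreover have "0 \<le> nrm (linf G) (?r f)"
    proof -
      have "bdd_above ((\<lambda>x. cmod (?r f x)) ` carrier G)"
        using C by (auto intro!: bdd_aboveI2)
      then have "cmod (?r f \<one>) \<le> nrm (linf G) (?r f)"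
        unfolding linf_def by (auto intro!: cSUP_upper2 [OF _ one_closed])
      then show ?thesis using norm_ge_zero order_trans by blast
    qed
    ultimately have "K * nrm (linf G) (?r f) \<le> max K 0 * C"
      by (intro mult_mono) auto
    then show ?thesis using K [OF r [OF f]] by linarith
  qed
  have "m (?r (\<lambda>x. f x + g x)) = m (?r f) + m (?r g)" if "bounded_fun f" "bounded_fun g" for f g
  proof -
    have "?r (\<lambda>x. f x + g x) = ?r f \<oplus>\<^bsub>linf G\<^esub> ?r g" by (auto simp: linf_def)
    then show ?thesis using m r that by (simp add: bounded_functional_def)
  qed
  moreover have "m (?r (\<lambda>x. c * f x)) = c * m (?r f)" if "bounded_fun f" for c f
  proof -
    have "?r (\<lambda>x. c * f x) = c \<odot>\<^bsub>linf G\<^esub> ?r f" by (auto simp: linf_def)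
    then show ?thesis using m r that by (simp add: bounded_functional_def)
  qed
  ultimately have "bounded_form (\<lambda>f. m (?r f))"
    using bd unfolding bounded_form_def by blast
  moreover have "m (?r (\<lambda>x. 1)) = 1" using one by (simp add: linf_def)
  moreover have "m (?r (\<lambda>x. f (g \<otimes> x))) = m (?r f)" if "g \<in> carrier G" "bounded_fun f" for f g
  proof -
    have "?r (\<lambda>x. f (g \<otimes> x)) = left_translate G g (?r f)"
      using that by (auto simp: left_translate_def)
    then show ?thesis using inv [OF that(1) r [OF that(2)]] by simp
  qed
  ultimately show ?thesis unfolding invariant_mean_def by blast
qed

lemma invariant_meanD:
  assumes "invariant_mean m"
  shows "bounded_form m" "m (\<lambda>x. 1) = 1"
    and "\<And>g f. g \<in> carrier G \<Longrightarrow> bounded_fun f \<Longrightarrow> m (\<lambda>x. f (g \<otimes> x)) = m f"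
  using assms unfolding invariant_mean_def by blast+

lemma invariant_mean_const: "invariant_mean m \<Longrightarrow> m (\<lambda>x. c) = c"
  using bounded_formD(2) [OF invariant_meanD(1), of m "\<lambda>x. 1" c] invariant_meanD(2) [of m] by simp

text \<open>The fibres of \<open>\<phi>\<close> are null because each has infinitely many pairwise disjoint translates.\<close>

lemma ex_generalized_limit:
  assumes m: "invariant_mean m" and inf: "infinite (carrier G)"
  shows "\<exists>\<phi>. \<forall>f c. bounded_fun (\<lambda>x. f (\<phi> x)) \<longrightarrow> (\<forall>\<^sub>F n :: nat in sequentially. f n = c) \<longrightarrow> m (\<lambda>x. f (\<phi> x)) = c"
proof -
  note bm = invariant_meanD(1) [OF m]
  obtain C where C: "subgroup C G" "countable C" "infinite C"
    using ex_countable_infinite_subgroup [OF inf] by blast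
  note Cc [simp] = subgroup.mem_carrier [OF C(1)]
  obtain \<nu> where \<nu>: "\<And>x. x \<in> carrier G \<Longrightarrow> \<nu> x \<in> C"
    and \<nu>eq: "\<And>h x. h \<in> C \<Longrightarrow> x \<in> carrier G \<Longrightarrow> \<nu> (h \<otimes> x) = h \<otimes> \<nu> x"
    using ex_left_equivariant [OF C(1)] by blast
  let ?d = "\<lambda>c. m (\<lambda>x. of_bool (\<nu> x = c))"
  have eq: "?d c = ?d \<one>" if c: "c \<in> C" for c
  proof -
    have "m (\<lambda>x. of_bool (\<nu> (c \<otimes> x) = c)) = ?d c"
      using invariant_meanD(3) [OF m, of c "\<lambda>x. of_bool (\<nu> x = c)"] c by simp
    moreover have "m (\<lambda>x. of_bool (\<nu> (c \<otimes> x) = c)) = ?d \<one>"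
      using \<nu> c by (intro bounded_form_cong [OF bm]) (auto simp: \<nu>eq)
    ultimately show ?thesis by simp
  qed
  obtain K where K: "\<And>f C. (\<forall>x\<in>carrier G. cmod (f x) \<le> C) \<Longrightarrow> cmod (m f) \<le> K * C"
    using bounded_formD(3) [OF bm] by blast
  have le: "real k * cmod (?d \<one>) \<le> K" for k :: nat
  proof -
    obtain F where F: "finite F" "card F = k" "F \<subseteq> C"
      using infinite_arbitrarily_large [OF C(3)] by blast
    have "cmod (\<Sum>c\<in>F. of_bool (\<nu> x = c)) \<le> 1" for x
      using F(1) by (simp add: of_bool_def sum.delta)
    then have "cmod (m (\<lambda>x. \<Sum>c\<in>F. of_bool (\<nu> x = c))) \<le> K * 1" by (intro K) simp
    also have "m (\<lambda>x. \<Sum>c\<in>F. of_bool (\<nu> x = c)) = (\<Sum>c\<in>F. ?d c)"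
      by (rule bounded_form_sum [OF bm F(1)]) simp
    also have "\<dots> = (\<Sum>c\<in>F. ?d \<one>)"
      using F(3) by (intro sum.cong refl eq) auto
    finally show ?thesis using F(2) by (simp add: norm_mult)
  qed
  have d1: "?d \<one> = 0"
  proof (rule ccontr)
    assume "?d \<one> \<noteq> 0"
    then obtain k where "K < real k * cmod (?d \<one>)"
      using reals_Archimedean3 [of "cmod (?d \<one>)"] by auto
    with le [of k] show False by simp
  qed
  \<comment> \<open>Numbering the values of \<open>\<nu>\<close> pushes the mean forward to a
    finitely additive functional on the naturals for which singletons are null.\<close>
  define \<phi> where "\<phi> x = to_nat_on C (\<nu> x)" for x
  have null: "m (\<lambda>x. of_bool (\<phi> x = n)) = 0" for n
  proof -
    obtain c where c: "c \<in> C" "to_nat_on C c = n"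
      using to_nat_on_surj [OF C(2,3)] by blast
    have "m (\<lambda>x. of_bool (\<phi> x = n)) = ?d c"
      using c \<nu> C(2) by (intro bounded_form_cong [OF bm]) (auto simp: \<phi>_def)
    then show ?thesis using eq [OF c(1)] d1 by simp
  qed
  have "m (\<lambda>x. f (\<phi> x)) = c"
    if f: "bounded_fun (\<lambda>x. f (\<phi> x))" and ev: "\<forall>\<^sub>F n in sequentially. f n = c" for f c
  proof -
    obtain k where k: "\<And>n. n \<ge> k \<Longrightarrow> f n = c" using ev by (auto simp: eventually_sequentially)
    \<comment> \<open>An eventually constant \<open>f\<close> differs from \<open>c\<close> at
      finitely many indices, so the correction is a finite combination of indicators of null
      fibres.\<close>
    have "f (\<phi> x) = c + (\<Sum>n<k. (f n - c) * of_bool (\<phi> x = n))" for x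
      using k [of "\<phi> x"] by (auto simp: of_bool_def if_distrib sum.delta' not_less cong: if_cong)
    then have "m (\<lambda>x. f (\<phi> x)) = m (\<lambda>x. c + (\<Sum>n<k. (f n - c) * of_bool (\<phi> x = n)))"
      by (simp only:)
    also have "\<dots> = m (\<lambda>x. c) + m (\<lambda>x. \<Sum>n<k. (f n - c) * of_bool (\<phi> x = n))"
      by (intro bounded_formD(1) [OF bm] bounded_fun_sum bounded_fun_mult) auto
    also have "m (\<lambda>x. \<Sum>n<k. (f n - c) * of_bool (\<phi> x = n)) = (\<Sum>n<k. m (\<lambda>x. (f n - c) * of_bool (\<phi> x = n)))"
      by (intro bounded_form_sum [OF bm] bounded_fun_mult) auto
    also have "\<dots> = 0"
      by (intro sum.neutral ballI) (simp add: bounded_formD(2) [OF bm] null)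
    finally show ?thesis by (simp add: invariant_mean_const [OF m])
  qed
  then show ?thesis by blast
qed

text \<open>The functional is the product of the mean of \<open>G\<close>, pushed to
  \<open>H\<close> along \<open>\<nu>\<close>, with a generalized limit of the differences of point
  masses at \<open>y n\<close> and \<open>z n\<close>. The first factor gives left
  \<open>H\<close>-invariance. A right \<open>H\<close>-invariant function cannot distinguish
  \<open>y n\<close> from \<open>z n\<close>, so it is sent to 0. On the indicator of
  \<open>A\<close> the two limits are 1 and 0.\<close>

lemma ex_null_ideal_element:
  assumes am: "amenable G" and inf: "infinite (carrier G)" and H: "subgroup H G"
    and yz: "\<And>n :: nat. y n \<in> H" "\<And>n. z n \<in> H"
    and A: "\<And>x. x \<in> H \<Longrightarrow> \<forall>\<^sub>F n in sequentially. x \<otimes> y n \<in> A"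
      "\<And>x. x \<in> H \<Longrightarrow> \<forall>\<^sub>F n in sequentially. x \<otimes> z n \<notin> A"
  shows "\<exists>\<Phi>\<in>null_ideal H H. pairing \<Phi> (\<lambda>x. of_bool (x \<in> A)) = 1"
proof -
  note Hc [simp] = subgroup.mem_carrier [OF H]
  obtain m where m: "invariant_mean m" using amenable_invariant_mean [OF am] by blast
  note bm = invariant_meanD(1) [OF m]
  obtain \<phi> where lim: "\<And>f c. bounded_fun (\<lambda>x. f (\<phi> x)) \<Longrightarrow> (\<forall>\<^sub>F n :: nat in sequentially. f n = c) \<Longrightarrow>
      m (\<lambda>x. f (\<phi> x)) = c"
    using ex_generalized_limit [OF m inf] by blast
  obtain \<nu> where \<nu> [simp]: "\<And>x. x \<in> carrier G \<Longrightarrow> \<nu> x \<in> H"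
    and \<nu>eq: "\<And>h x. h \<in> H \<Longrightarrow> x \<in> carrier G \<Longrightarrow> \<nu> (h \<otimes> x) = h \<otimes> \<nu> x"
    using ex_left_equivariant [OF H] by blast
  have \<nu>c [simp]: "x \<in> carrier G \<Longrightarrow> \<nu> x \<in> carrier G" for x using \<nu> by simp
  have yzc [simp]: "y n \<in> carrier G" "z n \<in> carrier G" for n using yz by simp_all
  define T where "T f x = m (\<lambda>u. f (\<nu> x \<otimes> y (\<phi> u)) - f (\<nu> x \<otimes> z (\<phi> u)))" for f x
  define p where "p f = m (T f)" for f
  have bf: "bounded_fun (\<lambda>u. f (\<nu> x \<otimes> y (\<phi> u)))" "bounded_fun (\<lambda>u. f (\<nu> x \<otimes> z (\<phi> u)))"
    if "bounded_fun f" "x \<in> carrier G" for f x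
    using that by (auto intro: bounded_fun_comp)
  have T_diff: "T f x = m (\<lambda>u. f (\<nu> x \<otimes> y (\<phi> u))) - m (\<lambda>u. f (\<nu> x \<otimes> z (\<phi> u)))"
    if "bounded_fun f" "x \<in> carrier G" for f x
    unfolding T_def by (rule bounded_form_diff [OF bm bf [OF that]])
  obtain K where K: "K \<ge> 0" "\<And>f C. (\<forall>x\<in>carrier G. cmod (f x) \<le> C) \<Longrightarrow> cmod (m f) \<le> K * C"
    using bounded_formD(3) [OF bm] by blast
  have T_le: "cmod (T f x) \<le> (K * 2) * C" if f: "\<forall>x\<in>carrier G. cmod (f x) \<le> C" and x: "x \<in> carrier G" for f C x
  proof -
    have "cmod (f (\<nu> x \<otimes> y (\<phi> u)) - f (\<nu> x \<otimes> z (\<phi> u))) \<le> 2 * C" for u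
    proof -
      have "cmod (f (\<nu> x \<otimes> y (\<phi> u))) \<le> C" "cmod (f (\<nu> x \<otimes> z (\<phi> u))) \<le> C" using f x by simp_all
      then show ?thesis using norm_triangle_ineq4 [of "f (\<nu> x \<otimes> y (\<phi> u))" "f (\<nu> x \<otimes> z (\<phi> u))"] by linarith
    qed
    then show ?thesis unfolding T_def mult.assoc by (intro K(2)) simp
  qed
  have T_bounded: "bounded_fun (T f)" if "bounded_fun f" for f
    using that T_le unfolding bounded_fun_def by meson
  have p: "bounded_form p"
    unfolding p_def
  proof (rule bounded_form_comp [OF bm])
    show "cmod (T f x) \<le> (K * 2) * C" if "\<forall>x\<in>carrier G. cmod (f x) \<le> C" "x \<in> carrier G" for f C x
      by (rule T_le [OF that])
    show "T (\<lambda>x. f x + g x) x = T f x + T g x" if "bounded_fun f" "bounded_fun g" "x \<in> carrier G" for f g x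
      using that by (simp add: T_diff bounded_fun_add bounded_formD(1) [OF bm] bf)
    show "T (\<lambda>x. c * f x) x = c * T f x" if "bounded_fun f" "x \<in> carrier G" for c f x
      using that by (simp add: T_diff bounded_fun_mult bounded_formD(2) [OF bm] bf algebra_simps)
  qed
  note pp = pairing_bidual_of [OF p]
  have "concentrated H (bidual_of p)"
    unfolding concentrated_def
  proof (intro allI impI)
    fix f g assume fg: "bounded_fun f" "bounded_fun g" and eq: "\<forall>x\<in>H. f x = g x"
    have "T f x = T g x" if "x \<in> carrier G" for x
      using that eq subgroup.m_closed [OF H] yz unfolding T_def by simp
    then have "p f = p g" unfolding p_def by (intro bounded_form_cong [OF bm T_bounded [OF fg(1)]])
    then show "pairing (bidual_of p) f = pairing (bidual_of p) g" using fg by (simp add: pp)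
  qed
  moreover have "pairing (bidual_of p) (\<lambda>x. f (h \<otimes> x)) = pairing (bidual_of p) f"
    if h: "h \<in> H" and f: "bounded_fun f" for h f
  proof -
    have "p (\<lambda>x. f (h \<otimes> x)) = m (\<lambda>x. T f (h \<otimes> x))"
      unfolding p_def using h f
      by (intro bounded_form_cong [OF bm] T_bounded bounded_fun_translate) (auto simp: T_def \<nu>eq m_assoc)
    also have "\<dots> = p f" unfolding p_def using h by (intro invariant_meanD(3) [OF m] T_bounded [OF f]) simp
    finally show ?thesis using f h by (simp add: pp bounded_fun_translate)
  qed
  moreover have "pairing (bidual_of p) f = 0"
    if f: "bounded_fun f" and inv: "\<forall>x\<in>carrier G. \<forall>h\<in>H. f (x \<otimes> h) = f x" for f
  proof -
    have "p f = m (\<lambda>x. 0)"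
      unfolding p_def using inv yz bounded_form_zero [OF bm]
      by (intro bounded_form_cong [OF bm T_bounded [OF f]]) (simp add: T_def)
    then show ?thesis using f by (simp add: pp bounded_form_zero [OF bm])
  qed
  ultimately have "bidual_of p \<in> null_ideal H H"
    using bidual_of_closed [OF p] by (simp add: null_ideal_def del: bidual_sel)
  moreover have "pairing (bidual_of p) (\<lambda>x. of_bool (x \<in> A)) = 1"
  proof -
    have "T (\<lambda>x. of_bool (x \<in> A)) x = 1" if x: "x \<in> carrier G" for x
    proof -
      have "m (\<lambda>u. of_bool (\<nu> x \<otimes> y (\<phi> u) \<in> A)) = 1"
        by (rule lim) (use A(1) [OF \<nu> [OF x]] in \<open>auto elim: eventually_mono\<close>)
      moreover have "m (\<lambda>u. of_bool (\<nu> x \<otimes> z (\<phi> u) \<in> A)) = 0"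
        by (rule lim) (use A(2) [OF \<nu> [OF x]] in \<open>auto elim: eventually_mono\<close>)
      ultimately show ?thesis using x by (simp add: T_diff)
    qed
    then have "p (\<lambda>x. of_bool (x \<in> A)) = m (\<lambda>x. 1)"
      unfolding p_def by (intro bounded_form_cong [OF bm T_bounded]) auto
    then show ?thesis by (simp add: pp invariant_meanD(2) [OF m])
  qed
  ultimately show ?thesis by blast
qed

lemma null_ideal_mono: "N \<subseteq> N' \<Longrightarrow> null_ideal M N \<subseteq> null_ideal M N'"
  unfolding null_ideal_def concentrated_def by blast

text \<open>For \<open>x\<close> in \<open>N\<close> and \<open>y\<close> in \<open>M\<close>,
  membership of \<open>x \<otimes> y\<close> in \<open>R\<close> depends on \<open>x\<close> alone
  and \<open>\<kappa> (x \<otimes> y) = \<kappa> x \<otimes> y\<close>. Invariance of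
  \<open>\<Psi>\<close> absorbs \<open>\<kappa> x\<close>, so the inner integral is the indicator of
  \<open>R\<close>, on which \<open>\<Phi>\<close> is 1.\<close>

lemma null_ideal_product_nonzero:
  assumes M: "subgroup M G" and N: "subgroup N G" and MN: "M \<subseteq> N"
    and \<Phi>: "\<Phi> \<in> null_ideal N N" "pairing \<Phi> (\<lambda>x. of_bool (x \<in> R)) = 1"
    and R: "\<And>x h. x \<in> N \<Longrightarrow> h \<in> M \<Longrightarrow> x \<otimes> h \<in> R \<longleftrightarrow> x \<in> R"
    and \<Psi>: "\<Psi> \<in> null_ideal M M" "pairing \<Psi> (\<lambda>x. of_bool (x \<in> A)) = 1"
  shows "\<Phi> \<otimes>\<^bsub>bidual (l1 G)\<^esub> \<Psi> \<noteq> \<zero>\<^bsub>bidual (l1 G)\<^esub>"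
proof -
  note Mc [simp] = subgroup.mem_carrier [OF M] and Nc [simp] = subgroup.mem_carrier [OF N]
  note \<Phi>D = null_idealD [OF \<Phi>(1)] and \<Psi>D = null_idealD [OF \<Psi>(1)]
  obtain \<kappa> where \<kappa>: "\<And>x. x \<in> carrier G \<Longrightarrow> \<kappa> x \<in> M"
    and \<kappa>eq: "\<And>x h. x \<in> carrier G \<Longrightarrow> h \<in> M \<Longrightarrow> \<kappa> (x \<otimes> h) = \<kappa> x \<otimes> h"
    using ex_right_equivariant [OF M] by blast
  \<comment> \<open>\<open>\<kappa> x\<close> serves as the \<open>M\<close>-coordinate of
    \<open>x\<close>, while \<open>R\<close> constrains only the coset of \<open>M\<close> that
    contains \<open>x\<close>.\<close>
  define f :: "'a \<Rightarrow> complex" where "f x = of_bool (x \<in> R \<and> \<kappa> x \<in> A)" for x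
  have f: "bounded_fun f" unfolding f_def by simp
  have inner: "pairing \<Psi> (\<lambda>y. f (x \<otimes> y)) = of_bool (x \<in> R)" if x: "x \<in> N" for x
  proof -
    let ?g = "\<lambda>y. of_bool (x \<in> R) * of_bool (\<kappa> x \<otimes> y \<in> A)"
    have "pairing \<Psi> (\<lambda>y. f (x \<otimes> y)) = pairing \<Psi> ?g"
      by (rule concentratedD [OF \<Psi>D(2)])
        (use x f R \<kappa>eq in \<open>auto simp: f_def bounded_fun_translate bounded_fun_mult\<close>)
    also have "\<dots> = of_bool (x \<in> R) * pairing \<Psi> (\<lambda>y. of_bool (\<kappa> x \<otimes> y \<in> A))"
      by (rule bounded_formD(2) [OF bounded_form_pairing [OF \<Psi>D(1)]]) simp
    also have "pairing \<Psi> (\<lambda>y. of_bool (\<kappa> x \<otimes> y \<in> A)) = 1"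
      using \<Psi>D(3) [OF \<kappa>, of x "\<lambda>y. of_bool (y \<in> A)"] x \<Psi>(2) by simp
    finally show ?thesis by simp
  qed
  have "pairing (\<Phi> \<otimes>\<^bsub>bidual (l1 G)\<^esub> \<Psi>) f = pairing \<Phi> (\<lambda>x. pairing \<Psi> (\<lambda>y. f (x \<otimes> y)))"
    by (rule pairing_mult [OF \<Phi>D(1) \<Psi>D(1) f])
  also have "\<dots> = pairing \<Phi> (\<lambda>x. of_bool (x \<in> R))"
    by (rule concentratedD [OF \<Phi>D(2)]) (simp_all add: bounded_fun_pairing \<Psi>D(1) f inner del: bidual_sel)
  also have "\<dots> = 1" by (rule \<Phi>(2))
  finally show ?thesis by (auto simp: pairing_zero simp del: bidual_sel)
qed

subsection \<open>Finite normal subgroups of a subgroup of finite index\<close>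

lemma normal_conj_image:
  assumes N: "N \<lhd> G" and M: "M \<lhd> G\<lparr>carrier := N\<rparr>" and s: "s \<in> carrier G"
  shows "(\<lambda>m. s \<otimes> m \<otimes> inv s) ` M \<lhd> G\<lparr>carrier := N\<rparr>"
proof -
  have Ns: "subgroup N G" using N by (rule normal_imp_subgroup)
  interpret GN: group "G\<lparr>carrier := N\<rparr>" by (rule subgroup.subgroup_is_group [OF Ns group_axioms])
  have Ms: "subgroup M (G\<lparr>carrier := N\<rparr>)" using M by (rule normal_imp_subgroup)
  have MN: "M \<subseteq> N" using subgroup.subset [OF Ms] by simp
  have MG: "subgroup M G" by (rule incl_subgroup [OF Ns Ms])
  note Nc [simp] = subgroup.mem_carrier [OF Ns] and Mc [simp] = subgroup.mem_carrier [OF MG]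
  let ?f = "\<lambda>m. s \<otimes> m \<otimes> inv s"
  have fN: "?f m \<in> N" if "m \<in> N" for m using normal.inv_op_closed2 [OF N s that] .
  have mult: "?f a \<otimes> ?f b = ?f (a \<otimes> b)" if "a \<in> carrier G" "b \<in> carrier G" for a b
  proof -
    have "inv s \<otimes> (s \<otimes> (b \<otimes> inv s)) = b \<otimes> inv s" using s that by (subst m_assoc [symmetric]) simp_all
    then show ?thesis using s that by (simp add: m_assoc)
  qed
  have inv: "inv (?f a) = ?f (inv a)" if "a \<in> carrier G" for a
    using s that by (simp add: inv_mult_group m_assoc)
  show ?thesis
  proof (rule GN.normal_invI)
    show "subgroup (?f ` M) (G\<lparr>carrier := N\<rparr>)"
    proof (rule GN.subgroupI)
      show "?f ` M \<subseteq> carrier (G\<lparr>carrier := N\<rparr>)" using fN MN by auto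
      show "?f ` M \<noteq> {}" using subgroup.one_closed [OF MG] by blast
    next
      fix a assume "a \<in> ?f ` M"
      then obtain m where m: "m \<in> M" "a = ?f m" by blast
      then have "inv\<^bsub>G\<lparr>carrier := N\<rparr>\<^esub> a = ?f (inv m)"
        using fN MN inv by (auto simp: m_inv_consistent [OF Ns])
      then show "inv\<^bsub>G\<lparr>carrier := N\<rparr>\<^esub> a \<in> ?f ` M" using m subgroup.m_inv_closed [OF MG] by blast
    next
      fix a b assume "a \<in> ?f ` M" "b \<in> ?f ` M"
      then obtain m n where m: "m \<in> M" "a = ?f m" "n \<in> M" "b = ?f n" by blast
      then have "a \<otimes> b = ?f (m \<otimes> n)" by (simp add: mult)
      then show "a \<otimes>\<^bsub>G\<lparr>carrier := N\<rparr>\<^esub> b \<in> ?f ` M" using m subgroup.m_closed [OF MG] by auto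
    qed
  next
    fix x h assume x: "x \<in> carrier (G\<lparr>carrier := N\<rparr>)" and "h \<in> ?f ` M"
    then obtain m where m: "m \<in> M" "h = ?f m" by blast
    have xN: "x \<in> N" using x by simp
    \<comment> \<open>Conjugation of \<open>s \<otimes> m \<otimes> inv s\<close> by
      \<open>x\<close> is the \<open>s\<close>-conjugate of conjugation of \<open>m\<close> by
      \<open>x'\<close>, and \<open>x'\<close> is again in \<open>N\<close>.\<close>
    define x' where "x' = inv s \<otimes> x \<otimes> s"
    have x': "x' \<in> N" unfolding x'_def by (rule normal.inv_op_closed1 [OF N s xN])
    have x'm: "x' \<otimes> m \<otimes> inv x' \<in> M"
      using normal.inv_op_closed2 [OF M, of x' m] x' m(1) by (simp add: m_inv_consistent [OF Ns])
    have "?f x' = x"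
    proof -
      have "s \<otimes> (inv s \<otimes> (x \<otimes> (s \<otimes> inv s))) = x" using s xN by (subst m_assoc [symmetric]) simp_all
      then show ?thesis unfolding x'_def using s xN by (simp add: m_assoc del: r_inv)
    qed
    then have "x \<otimes> h \<otimes> inv x = ?f (x' \<otimes> m \<otimes> inv x')"
      using m x' mult inv [of x'] by (metis Mc Nc inv_closed m_closed)
    then show "x \<otimes>\<^bsub>G\<lparr>carrier := N\<rparr>\<^esub> h \<otimes>\<^bsub>G\<lparr>carrier := N\<rparr>\<^esub> inv\<^bsub>G\<lparr>carrier := N\<rparr>\<^esub> x \<in> ?f ` M"
      using x'm xN by (simp add: m_inv_consistent [OF Ns])
  qed
qed

text \<open>As \<open>N\<close> normalises \<open>M\<close> and has finite index, \<open>M\<close>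
  has finitely many conjugates in \<open>G\<close>, each finite and normal in \<open>N\<close>. A
  finite product of them is a finite subgroup \<open>P\<close>, and the normal closure of
  \<open>M\<close> lies inside \<open>P\<close>.\<close>

lemma ex_finite_normal_supergroup:
  assumes N: "N \<lhd> G" and fin: "finite (rcosets N)" and M: "M \<lhd> G\<lparr>carrier := N\<rparr>" and Mfin: "finite M"
  shows "\<exists>K. K \<lhd> G \<and> finite K \<and> M \<subseteq> K"
proof -
  have Ns: "subgroup N G" using N by (rule normal_imp_subgroup)
  interpret GN: group "G\<lparr>carrier := N\<rparr>" by (rule subgroup.subgroup_is_group [OF Ns group_axioms])
  have Ms: "subgroup M (G\<lparr>carrier := N\<rparr>)" using M by (rule normal_imp_subgroup)
  have MG: "subgroup M G" by (rule incl_subgroup [OF Ns Ms])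
  note Nc [simp] = subgroup.mem_carrier [OF Ns] and Mc [simp] = subgroup.mem_carrier [OF MG]
  let ?c = "\<lambda>s m. s \<otimes> m \<otimes> inv s"
  have *: "\<exists>P. P \<lhd> G\<lparr>carrier := N\<rparr> \<and> finite P \<and> (\<forall>s\<in>S. ?c s ` M \<subseteq> P)"
    if "finite S" "S \<subseteq> carrier G" for S
    using that
  proof (induction S rule: finite_induct)
    case empty
    then show ?case using M Mfin by blast
  next
    case (insert s S)
    then obtain P where P: "P \<lhd> G\<lparr>carrier := N\<rparr>" "finite P" "\<forall>s\<in>S. ?c s ` M \<subseteq> P" by auto
    let ?Q = "?c s ` M"
    have Q: "?Q \<lhd> G\<lparr>carrier := N\<rparr>" using insert.prems by (intro normal_conj_image [OF N M]) simp
    have PG: "subgroup P G" and QG: "subgroup ?Q G"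
      using incl_subgroup [OF Ns] normal_imp_subgroup [OF P(1)] normal_imp_subgroup [OF Q] by blast+
    let ?PQ = "P <#>\<^bsub>G\<lparr>carrier := N\<rparr>\<^esub> ?Q"
    have PQ: "?PQ \<lhd> G\<lparr>carrier := N\<rparr>" by (rule GN.normal_subgroup_set_mult_closed [OF P(1) Q])
    have "P \<subseteq> ?PQ"
    proof
      fix a assume "a \<in> P"
      then have "a = a \<otimes> \<one>" using subgroup.mem_carrier [OF PG] by simp
      with \<open>a \<in> P\<close> subgroup.one_closed [OF QG] have "\<exists>q\<in>?Q. a = a \<otimes> q" by (intro bexI)
      then show "a \<in> ?PQ" using \<open>a \<in> P\<close> unfolding set_mult_def by auto
    qed
    moreover have "?Q \<subseteq> ?PQ"
    proof
      fix a assume a: "a \<in> ?Q"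
      then have "a = \<one> \<otimes> a" using subgroup.mem_carrier [OF QG] by simp
      then show "a \<in> ?PQ" using a subgroup.one_closed [OF PG] unfolding set_mult_def by auto
    qed
    moreover have "finite ?PQ" using P(2) Mfin unfolding set_mult_def by auto
    ultimately show ?case using PQ P(3) by (intro exI [of _ ?PQ]) blast
  qed
  obtain T where T: "finite T" "T \<subseteq> carrier G" "\<And>x. x \<in> carrier G \<Longrightarrow> \<exists>t\<in>T. x \<in> N #> t"
    using rcosets_transversal [OF Ns fin] by metis
  \<comment> \<open>The transversal is for cosets \<open>N #> t\<close>. From
    \<open>inv g = n \<otimes> t\<close> one gets \<open>g = inv t \<otimes> inv n\<close>, where
    conjugation by \<open>inv n\<close> maps \<open>M\<close> to itself; hence the inverses of
    \<open>T\<close> represent all conjugates.\<close>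
  obtain P where P: "P \<lhd> G\<lparr>carrier := N\<rparr>" "finite P" "\<forall>s\<in>m_inv G ` T. ?c s ` M \<subseteq> P"
    using * [of "m_inv G ` T"] T(1,2) by auto
  have PG: "subgroup P G" using incl_subgroup [OF Ns normal_imp_subgroup [OF P(1)]] .
  have conj: "?c (g \<otimes> h) m = ?c g (?c h m)" if "g \<in> carrier G" "h \<in> carrier G" "m \<in> carrier G" for g h m
    using that by (simp add: inv_mult_group m_assoc)
  let ?K = "\<Union>g\<in>carrier G. ?c g ` M"
  have "?c g m \<in> P" if g: "g \<in> carrier G" and m: "m \<in> M" for g m
  proof -
    obtain t where t: "t \<in> T" "inv g \<in> N #> t" using T(3) g by blast
    then obtain n where n: "n \<in> N" "inv g = n \<otimes> t" by (auto simp: r_coset_def)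
    have tc: "t \<in> carrier G" using t T(2) by blast
    have "g = inv (n \<otimes> t)" using n(2) g by (metis inv_inv)
    then have "g = inv t \<otimes> inv n" using n(1) tc by (simp add: inv_mult_group)
    then have "?c g m = ?c (inv t) (?c (inv n) m)" using conj [of "inv t" "inv n" m] n(1) tc m by simp
    moreover have "?c (inv n) m \<in> M"
      using normal.inv_op_closed1 [OF M, of n m] n(1) m by (simp add: m_inv_consistent [OF Ns])
    ultimately show ?thesis using P(3) t(1) by blast
  qed
  then have KP: "?K \<subseteq> P" by blast
  have Kc: "?K \<subseteq> carrier G" using KP subgroup.subset [OF PG] by blast
  have "generate G ?K \<lhd> G"
  proof (rule normal_generateI [OF Kc])
    fix h g assume "h \<in> ?K" and g: "g \<in> carrier G"
    then obtain k m where k: "k \<in> carrier G" "m \<in> M" "h = ?c k m" by blast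
    then have "?c g h = ?c (g \<otimes> k) m" using conj [OF g k(1), of m] by simp
    then show "?c g h \<in> ?K" using k g by blast
  qed
  moreover have "finite (generate G ?K)"
    using generate_subgroup_incl [OF KP PG] P(2) finite_subset by blast
  moreover have "M \<subseteq> generate G ?K"
  proof
    fix m assume m: "m \<in> M"
    then have "m = ?c \<one> m" by simp
    then show "m \<in> generate G ?K" using m by (intro generate.incl) blast
  qed
  ultimately show ?thesis by blast
qed

lemma finite_carrierI:
  assumes H: "subgroup H G" and "finite H" "finite (rcosets H)"
  shows "finite (carrier G)"
  using rcosets_part_G [OF H] assms rcosets_finite [OF _ subgroup.subset [OF H]] finite_Union by metis

end

section \<open>Contradiction from a normal subgroup that is not just infinite\<close>

theorem theorem1p3:
  fixes G :: "('g, 'm) monoid_scheme"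
  assumes "group G"
    and "amenable G"
    and "just_infinite G"
    and "\<forall>\<Phi>\<in>jacobson_radical (bidual (l1 G)). \<forall>\<Psi>\<in>jacobson_radical (bidual (l1 G)).
           \<Phi> \<otimes>\<^bsub>bidual (l1 G)\<^esub> \<Psi> = \<zero>\<^bsub>bidual (l1 G)\<^esub>"
  shows "hereditarily_just_infinite G"
proof (rule ccontr)
  interpret group G by (rule assms(1))
  have inf: "infinite (carrier G)"
    and ji: "\<And>N. N \<lhd> G \<Longrightarrow> N \<noteq> {\<one>\<^bsub>G\<^esub>} \<Longrightarrow> finite (rcosets\<^bsub>G\<^esub> N)"
    using assms(3) by (auto simp: just_infinite_def)
  assume "\<not> hereditarily_just_infinite G"
  then obtain N where N: "N \<lhd> G" "N \<noteq> {\<one>\<^bsub>G\<^esub>}" and nji: "\<not> just_infinite (G\<lparr>carrier := N\<rparr>)"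
    using inf by (auto simp: hereditarily_just_infinite_def)
  have finN: "finite (rcosets\<^bsub>G\<^esub> N)" by (rule ji [OF N])
  have Ns: "subgroup N G" using N(1) by (rule normal_imp_subgroup)
  have infN: "infinite N" using finite_carrierI [OF Ns _ finN] inf by blast
  interpret GN: group "G\<lparr>carrier := N\<rparr>" by (rule subgroup.subgroup_is_group [OF Ns group_axioms])
  obtain M where M: "M \<lhd> G\<lparr>carrier := N\<rparr>" "M \<noteq> {\<one>\<^bsub>G\<^esub>}"
    and infQ: "infinite (rcosets\<^bsub>G\<lparr>carrier := N\<rparr>\<^esub> M)"
    using nji infN by (auto simp: just_infinite_def)
  have Ms: "subgroup M (G\<lparr>carrier := N\<rparr>)" using M(1) by (rule normal_imp_subgroup)
  have MN: "M \<subseteq> N" using subgroup.subset [OF Ms] by simp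
  have MG: "subgroup M G" by (rule incl_subgroup [OF Ns Ms])
  have infM: "infinite M"
  proof
    assume "finite M"
    then obtain K where K: "K \<lhd> G" "finite K" "M \<subseteq> K"
      using ex_finite_normal_supergroup [OF N(1) finN M(1)] by blast
    \<comment> \<open>A non-trivial normal \<open>K\<close> has finite index by just infiniteness;
      being finite too, it would make \<open>G\<close> finite.\<close>
    have "K \<noteq> {\<one>\<^bsub>G\<^esub>}"
      using M(2) K(3) subgroup.one_closed [OF MG] by blast
    then show False
      using finite_carrierI [OF normal_imp_subgroup [OF K(1)] K(2) ji [OF K(1)]] inf by blast
  qed
  interpret GM: group "G\<lparr>carrier := M\<rparr>" by (rule subgroup.subgroup_is_group [OF MG group_axioms])
  obtain A and y z :: "nat \<Rightarrow> 'g" where A: "\<forall>n. y n \<in> M \<and> z n \<in> M"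
    "\<forall>x\<in>M. (\<forall>\<^sub>F n in sequentially. x \<otimes>\<^bsub>G\<^esub> y n \<in> A) \<and> (\<forall>\<^sub>F n in sequentially. x \<otimes>\<^bsub>G\<^esub> z n \<notin> A)"
    using GM.ex_bithick_set infM by auto
  obtain \<Psi> where \<Psi>: "\<Psi> \<in> null_ideal M M" "pairing \<Psi> (\<lambda>x. of_bool (x \<in> A)) = 1"
    using ex_null_ideal_element [OF assms(2) inf MG, of y z A] A by auto
  obtain R and y z :: "nat \<Rightarrow> 'g" where R: "\<forall>x\<in>N. \<forall>h\<in>M. x \<otimes>\<^bsub>G\<^esub> h \<in> R \<longleftrightarrow> x \<in> R"
    "\<forall>n. y n \<in> N \<and> z n \<in> N"
    "\<forall>x\<in>N. (\<forall>\<^sub>F n in sequentially. x \<otimes>\<^bsub>G\<^esub> y n \<in> R) \<and> (\<forall>\<^sub>F n in sequentially. x \<otimes>\<^bsub>G\<^esub> z n \<notin> R)"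
    using normal.ex_invariant_bithick_set [OF M(1) infQ] by auto
  obtain \<Phi> where \<Phi>: "\<Phi> \<in> null_ideal N N" "pairing \<Phi> (\<lambda>x. of_bool (x \<in> R)) = 1"
    using ex_null_ideal_element [OF assms(2) inf Ns, of y z R] R(2,3) by auto
  have conjM: "inv\<^bsub>G\<^esub> y \<otimes>\<^bsub>G\<^esub> m \<otimes>\<^bsub>G\<^esub> y \<in> M" if "y \<in> N" "m \<in> M" for y m
    using normal.inv_op_closed1 [OF M(1), of y m] that by (simp add: m_inv_consistent [OF Ns])
  have conjN: "inv\<^bsub>G\<^esub> y \<otimes>\<^bsub>G\<^esub> m \<otimes>\<^bsub>G\<^esub> y \<in> N" if "y \<in> N" "m \<in> N" for y m
    using that Ns by (simp add: subgroup.m_closed subgroup.m_inv_closed)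
  have "\<Phi> \<in> jacobson_radical (bidual (l1 G))"
    using null_ideal_subset_radical [OF N(1) finN subset_refl conjN] \<Phi>(1) by blast
  \<comment> \<open>\<open>\<Psi>\<close> is concentrated on \<open>M\<close>, but the radical
    criterion needs a normal subgroup of finite index, so it is regarded as concentrated on the
    larger \<open>N\<close>.\<close>
  moreover have "\<Psi> \<in> jacobson_radical (bidual (l1 G))"
    using null_ideal_subset_radical [OF N(1) finN MN conjM] \<Psi>(1) null_ideal_mono [OF MN] by blast
  ultimately have "\<Phi> \<otimes>\<^bsub>bidual (l1 G)\<^esub> \<Psi> = \<zero>\<^bsub>bidual (l1 G)\<^esub>"
    using assms(4) by blast
  then show False
    using null_ideal_product_nonzero [OF MG Ns MN \<Phi> _ \<Psi>] R(1) by blast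
qed

end
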